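(* Consider the setting described in the context, assume A1–A5, and let $s=\frac{r}{2-4r}$. A sequence $f_n$ with $cn^{-r}\le\|f_n\|\le Cn^{-r}$ (constants $0<c<C$) is purely $n^{-r}$-consistent if and only if for every $\varepsilon>0$ there are $P_\varepsilon>0$ and a sequence $f_{1n}\in\bar{\mathbb{B}}^s_{2\infty}(P_\varepsilon)$ such that $\|f_n-f_{1n}\|\le\varepsilon n^{-r}$ and $\|f_n\|^2=\|f_{1n}\|^2+\|f_n-f_{1n}\|^2$.
   Context: Fix $\sigma>0$, $0<r<1/2$ and an orthonormal basis $(\phi_j)_{j\ge1}$ of $\mathbb{L}_2(0,1)$. For each $n$ one observes $dY_n(t)=f(t)\,dt+\sigma n^{-1/2}dw(t)$, equivalently $y_j=\theta_j+\sigma n^{-1/2}\xi_j$, $\theta_j=\int_0^1f\phi_j$, $\xi_j$ i.i.d. $N(0,1)$; $H_0:f=0$. Weights $\kappa_{nj}^2\ge0$, $\rho_n=\sum_j\kappa_{nj}^2$, $T_n(Y_n)=\sum_j\kappa_{nj}^2y_j^2-\sigma^2n^{-1}\rho_n$, $k_n=\sup\{k:\sum_{j<k}\kappa_{nj}^2\le\rho_n/2\}$, $\kappa_n^2=\kappa_{nk_n}^2$. Assumptions: (A1) $j\mapsto\kappa_{nj}^2$ decreasing; (A2) $C_1<\sigma^{-4}n^2\sum_j\kappa_{nj}^4<C_2$; (A3) $c_1n^{-2r}\le\rho_n\le c_2n^{-2r}$; (A4) $\exists C_1>0,\lambda>1$: $\kappa^2_{n,[(1+\delta)k_n]}<C_1(1+\delta)^{-\lambda}\kappa_n^2$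 for all $\delta>0,n$; (A5) $\kappa_{n1}^2\asymp\kappa_n^2$ and for each $c>1$ there is $C>0$ with $\kappa^2_{n,[ck_n]}\ge C\kappa_n^2$. A test generated by $T_n$ rejects $H_0$ iff $T_n$ exceeds a threshold. A (sub)sequence $f_{n_i}$ is consistent if for every $\alpha\in(0,1)$ and every sequence of tests $K_{n_i}$ generated by $T_{n_i}$ with $\alpha(K_{n_i})=\alpha(1+o(1))$, $\limsup_i\beta(K_{n_i},f_{n_i})<1-\alpha$; inconsistent if for every sequence of such tests (any level) $\liminf_i(\alpha(K_{n_i})+\beta(K_{n_i},f_{n_i}))\ge1$. $f_n$ is $n^{-r}$-consistent if consistent with $cn^{-r}<\|f_n\|<Cn^{-r}$ for some $0<c<C$; it is purely $n^{-r}$-consistent if there is no subsequence with $f_{n_i}=f_{1n_i}+f_{2n_i}$, $f_{2n_i}\perp f_{1n_i}$, $\|f_{2n_i}\|>c_1n_i^{-r}$ for some $c_1>0$, and $f_{2n_i}$ inconsistent. $\bar{\mathbb{B}}^s_{2\infty}(P_0)=\{f=\sum_j\theta_j\phi_j:\ \sup_{\lambda>0}\lambda^{2s}\sum_{j>\lambda}\theta_j^2\le P_0\}$. *)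

theory Defs
  imports "HOL-Probability.Probability"
begin

(* Functions f in L2(0,1) are represented by their coefficient sequences
   theta_j = <f, phi_j>, j >= 1 (the value at index 0 is ignored). *)

definition ell2 :: "(nat \<Rightarrow> real) \<Rightarrow> bool" where
  "ell2 \<theta> \<longleftrightarrow> (\<lambda>j. (\<theta> j)^2) summable_on {1..}"

definition l2norm :: "(nat \<Rightarrow> real) \<Rightarrow> real" where
  "l2norm \<theta> = sqrt (\<Sum>\<^sub>\<infinity>j\<in>{1..}. (\<theta> j)^2)"

definition l2inner :: "(nat \<Rightarrow> real) \<Rightarrow> (nat \<Rightarrow> real) \<Rightarrow> real" where
  "l2inner \<theta> \<eta> = (\<Sum>\<^sub>\<infinity>j\<in>{1..}. \<theta> j * \<eta> j)"

(* kappa n j stands for kappa_{nj}^2 *)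
definition rho :: "(nat \<Rightarrow> nat \<Rightarrow> real) \<Rightarrow> nat \<Rightarrow> real" where
  "rho \<kappa> n = (\<Sum>\<^sub>\<infinity>j\<in>{1..}. \<kappa> n j)"

definition kn :: "(nat \<Rightarrow> nat \<Rightarrow> real) \<Rightarrow> nat \<Rightarrow> nat" where
  "kn \<kappa> n = Sup {k::nat. (\<Sum>j\<in>{1..<k}. \<kappa> n j) \<le> rho \<kappa> n / 2}"

definition kappa_n :: "(nat \<Rightarrow> nat \<Rightarrow> real) \<Rightarrow> nat \<Rightarrow> real" where
  "kappa_n \<kappa> n = \<kappa> n (kn \<kappa> n)"

(* T_n(Y_n) with y_j = theta_j + sigma n^{-1/2} xi_j *)
definition Tstat :: "real \<Rightarrow> (nat \<Rightarrow> nat \<Rightarrow> real) \<Rightarrow> (nat \<Rightarrow> 'a \<Rightarrow> real) \<Rightarrow> nat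
    \<Rightarrow> (nat \<Rightarrow> real) \<Rightarrow> 'a \<Rightarrow> real" where
  "Tstat \<sigma> \<kappa> \<xi> n \<theta> \<omega> =
     (\<Sum>\<^sub>\<infinity>j\<in>{1..}. \<kappa> n j * (\<theta> j + \<sigma> / sqrt (real n) * \<xi> j \<omega>)^2)
     - \<sigma>^2 / real n * rho \<kappa> n"

definition errI :: "'a measure \<Rightarrow> real \<Rightarrow> (nat \<Rightarrow> nat \<Rightarrow> real) \<Rightarrow> (nat \<Rightarrow> 'a \<Rightarrow> real)
    \<Rightarrow> nat \<Rightarrow> real \<Rightarrow> real" where
  "errI M \<sigma> \<kappa> \<xi> n t = measure M {\<omega> \<in> space M. Tstat \<sigma> \<kappa> \<xi> n (\<lambda>_. 0) \<omega> > t}"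

definition errII :: "'a measure \<Rightarrow> real \<Rightarrow> (nat \<Rightarrow> nat \<Rightarrow> real) \<Rightarrow> (nat \<Rightarrow> 'a \<Rightarrow> real)
    \<Rightarrow> nat \<Rightarrow> (nat \<Rightarrow> real) \<Rightarrow> real \<Rightarrow> real" where
  "errII M \<sigma> \<kappa> \<xi> n \<theta> t = measure M {\<omega> \<in> space M. Tstat \<sigma> \<kappa> \<xi> n \<theta> \<omega> \<le> t}"

(* the sequence g i (= f_{n_i}) at sample sizes ns i; tests given by thresholds t i *)
definition consistent :: "'a measure \<Rightarrow> real \<Rightarrow> (nat \<Rightarrow> nat \<Rightarrow> real) \<Rightarrow> (nat \<Rightarrow> 'a \<Rightarrow> real)
    \<Rightarrow> (nat \<Rightarrow> nat) \<Rightarrow> (nat \<Rightarrow> nat \<Rightarrow> real) \<Rightarrow> bool" where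
  "consistent M \<sigma> \<kappa> \<xi> ns g \<longleftrightarrow>
     (\<forall>\<alpha>::real. 0 < \<alpha> \<and> \<alpha> < 1 \<longrightarrow>
       (\<forall>t::nat \<Rightarrow> real.
          (\<lambda>i. errI M \<sigma> \<kappa> \<xi> (ns i) (t i)) \<longlonglongrightarrow> \<alpha> \<longrightarrow>
          limsup (\<lambda>i. ereal (errII M \<sigma> \<kappa> \<xi> (ns i) (g i) (t i))) < ereal (1 - \<alpha>)))"

definition inconsistent :: "'a measure \<Rightarrow> real \<Rightarrow> (nat \<Rightarrow> nat \<Rightarrow> real) \<Rightarrow> (nat \<Rightarrow> 'a \<Rightarrow> real)
    \<Rightarrow> (nat \<Rightarrow> nat) \<Rightarrow> (nat \<Rightarrow> nat \<Rightarrow> real) \<Rightarrow> bool" where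
  "inconsistent M \<sigma> \<kappa> \<xi> ns g \<longleftrightarrow>
     (\<forall>t::nat \<Rightarrow> real.
        liminf (\<lambda>i. ereal (errI M \<sigma> \<kappa> \<xi> (ns i) (t i) + errII M \<sigma> \<kappa> \<xi> (ns i) (g i) (t i))) \<ge> 1)"

definition r_consistent :: "'a measure \<Rightarrow> real \<Rightarrow> (nat \<Rightarrow> nat \<Rightarrow> real) \<Rightarrow> (nat \<Rightarrow> 'a \<Rightarrow> real)
    \<Rightarrow> real \<Rightarrow> (nat \<Rightarrow> nat \<Rightarrow> real) \<Rightarrow> bool" where
  "r_consistent M \<sigma> \<kappa> \<xi> r f \<longleftrightarrow>
     consistent M \<sigma> \<kappa> \<xi> id f \<and>
     (\<exists>c C. 0 < c \<and> c < C \<and> (\<forall>n\<ge>1. c * real n powr (-r) < l2norm (f n)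
                                      \<and> l2norm (f n) < C * real n powr (-r)))"

definition purely_r_consistent :: "'a measure \<Rightarrow> real \<Rightarrow> (nat \<Rightarrow> nat \<Rightarrow> real) \<Rightarrow> (nat \<Rightarrow> 'a \<Rightarrow> real)
    \<Rightarrow> real \<Rightarrow> (nat \<Rightarrow> nat \<Rightarrow> real) \<Rightarrow> bool" where
  "purely_r_consistent M \<sigma> \<kappa> \<xi> r f \<longleftrightarrow>
     r_consistent M \<sigma> \<kappa> \<xi> r f \<and>
     \<not> (\<exists>ns f2 c1. strict_mono ns \<and> (\<forall>i. 1 \<le> ns i) \<and> 0 < c1 \<and>
          (\<forall>i. ell2 (f2 i) \<and> l2inner (f2 i) (\<lambda>j. f (ns i) j - f2 i j) = 0
               \<and> l2norm (f2 i) > c1 * real (ns i) powr (-r)) \<and>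
          inconsistent M \<sigma> \<kappa> \<xi> ns f2)"

definition besov :: "real \<Rightarrow> real \<Rightarrow> (nat \<Rightarrow> real) set" where
  "besov s P0 = {\<theta>. \<forall>L::real. L > 0 \<longrightarrow>
        L powr (2 * s) * (\<Sum>\<^sub>\<infinity>j\<in>{j. 1 \<le> j \<and> real j > L}. (\<theta> j)^2) \<le> P0}"

end

theory Submission
  imports Defs
begin

text \<open>
  Standardising \<open>T\<^sub>n\<close> by its null standard deviation, which is of order \<open>n\<^sup>-\<^sup>2\<close>, makes it
  \<open>\<Sum> w\<^sub>j (\<xi>\<^sub>j\<^sup>2 - 1) + \<Sum> w\<^sub>j h\<^sub>j\<^sup>2 + 2 \<Sum> w\<^sub>j h\<^sub>j \<xi>\<^sub>j\<close>. The first term is asymptotically normal because the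
  largest weight tends to zero, the last one is negligible as long as the second stays bounded.
  Hence a sequence with \<open>\<parallel>f\<^sub>n\<parallel> = O(n\<^sup>-\<^sup>r)\<close> is detected iff \<open>n\<^sup>2 \<Sum> \<kappa>\<^sub>n\<^sub>j\<^sup>2 \<theta>\<^sub>n\<^sub>j\<^sup>2\<close> stays away from zero,
  and goes unnoticed iff this quantity vanishes.

  The assumptions give \<open>k\<^sub>n \<asymp> n\<^sup>2\<^sup>-\<^sup>4\<^sup>r\<close> and \<open>\<kappa>\<^sub>n\<^sup>2 \<asymp> n\<^sup>2\<^sup>r\<^sup>-\<^sup>2\<close>, so a signal of norm \<open>n\<^sup>-\<^sup>r\<close> is visible iff a
  fixed share of its energy sits at frequencies \<open>j \<le> a k\<^sub>n\<close>, while a Besov ball of smoothness \<open>s\<close> bounds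
  the energy beyond \<open>a k\<^sub>n\<close> by a small multiple of \<open>n\<^sup>-\<^sup>2\<^sup>r\<close>. If \<open>f\<^sub>n\<close> is close to a Besov ball, any \<open>g\<close> with
  \<open>g \<bottom> f\<^sub>n - g\<close> correlates with \<open>f\<^sub>n\<close>, hence with its low frequencies, and is visible. Conversely,
  if the tails of \<open>f\<^sub>n\<close> beyond \<open>a k\<^sub>n\<close> were not uniformly small, some of them would form an invisible
  orthogonal part along a subsequence; so truncation at \<open>a k\<^sub>n\<close> provides the approximation.
\<close>

section \<open>The standard normal distribution function\<close>

lemma isCont_cdf_std_normal: "isCont (cdf std_normal_distribution) x"
proof -
  interpret N: real_distribution std_normal_distribution by (rule real_dist_normal_dist)
  have "emeasure std_normal_distribution {x} = 0"
    by (simp add: emeasure_density)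
  then show ?thesis by (simp add: N.isCont_cdf measure_def)
qed

lemma cdf_std_normal_diff:
  assumes "x < y"
  shows "cdf std_normal_distribution y - cdf std_normal_distribution x
    = measure std_normal_distribution {x<..y}"
proof -
  interpret N: real_distribution std_normal_distribution by (rule real_dist_normal_dist)
  show ?thesis using N.cdf_diff_eq[OF assms] .
qed

text \<open>The density decreases in the modulus of its argument, so on the interval it is bounded
  below by its positive value at the modulus of the endpoint farther from 0.\<close>

lemma cdf_std_normal_strict_mono:
  assumes "x < y"
  shows "cdf std_normal_distribution x < cdf std_normal_distribution y"
proof -
  define m where "m = max \<bar>x\<bar> \<bar>y\<bar>"
  interpret N: real_distribution std_normal_distribution by (rule real_dist_normal_dist)
  have "ennreal (std_normal_density m * (y - x)) = (\<integral>\<^sup>+z. ennreal (std_normal_density m) * indicator {x<..y} z \<partial>lborel)"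
    using assms by (subst nn_integral_cmult_indicator) (auto simp: ennreal_mult'')
  also have "\<dots> \<le> (\<integral>\<^sup>+z. ennreal (std_normal_density z) * indicator {x<..y} z \<partial>lborel)"
  proof (rule nn_integral_mono)
    fix z
    show "ennreal (std_normal_density m) * indicator {x<..y} z \<le> ennreal (std_normal_density z) * indicator {x<..y} z"
    proof (cases "z \<in> {x<..y}")
      case True
      then have "\<bar>z\<bar> \<le> \<bar>m\<bar>" by (auto simp: m_def)
      then have "z\<^sup>2 \<le> m\<^sup>2" by (simp add: abs_le_square_iff)
      then have "std_normal_density m \<le> std_normal_density z"
        by (simp add: normal_density_def divide_right_mono)
      then show ?thesis using True by (simp add: ennreal_leI)
    qed simp
  qed
  also have "\<dots> = emeasure std_normal_distribution {x<..y}"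
    by (simp add: emeasure_density)
  finally have "std_normal_density m * (y - x) \<le> measure std_normal_distribution {x<..y}"
    by (simp add: N.emeasure_eq_measure)
  moreover have "0 < std_normal_density m * (y - x)"
    using assms by (simp add: normal_density_pos)
  ultimately show ?thesis using cdf_std_normal_diff[OF assms] by simp
qed

text \<open>The density is at most 1. A small shift of the argument is therefore harmless
  simultaneously at all points, which the treatment of arbitrary thresholds relies on.\<close>

lemma cdf_std_normal_lipschitz:
  assumes "x \<le> y"
  shows "cdf std_normal_distribution y - cdf std_normal_distribution x \<le> y - x"
proof (cases "x = y")
  case False
  then have "x < y" using assms by simp
  interpret N: real_distribution std_normal_distribution by (rule real_dist_normal_dist)
  have le1: "std_normal_density z \<le> 1" for z
  proof -
    have "1 \<le> sqrt (2 * pi)" using pi_gt3 by simp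
    moreover have "exp (- (z\<^sup>2 / 2)) \<le> 1" by simp
    ultimately show ?thesis 
      unfolding normal_density_def using order_trans[of "exp (- (z\<^sup>2 / 2))" 1 "sqrt (2 * pi)"]
      by (simp add: divide_simps)
  qed
  have "emeasure std_normal_distribution {x<..y} = (\<integral>\<^sup>+z. ennreal (std_normal_density z) * indicator {x<..y} z \<partial>lborel)"
    by (simp add: emeasure_density)
  also have "\<dots> \<le> (\<integral>\<^sup>+z. 1 * indicator {x<..y} z \<partial>lborel)"
    using le1 by (intro nn_integral_mono mult_right_mono) (auto simp: ennreal_le_1)
  also have "\<dots> = ennreal (y - x)" using assms by simp
  finally have "measure std_normal_distribution {x<..y} \<le> y - x"
    using assms by (simp add: N.emeasure_eq_measure)
  then show ?thesis using cdf_std_normal_diff[OF \<open>x < y\<close>] by simp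
qed simp

lemma cdf_std_normal_quantile:
  assumes "0 < p" "p < 1"
  obtains x where "cdf std_normal_distribution x = p"
proof -
  interpret N: real_distribution std_normal_distribution by (rule real_dist_normal_dist)
  let ?F = "cdf std_normal_distribution"
  have "\<forall>\<^sub>F x in at_bot. ?F x < p" using N.cdf_lim_at_bot assms(1) by (rule order_tendstoD)
  then obtain a where a: "?F a < p" by (meson eventually_at_bot_linorder order_refl)
  have "\<forall>\<^sub>F x in at_top. p < ?F x" using N.cdf_lim_at_top_prob assms(2) by (rule order_tendstoD)
  then obtain c where c: "p < ?F c" by (meson eventually_at_top_linorder order_refl)
  have "a \<le> c" using a c N.cdf_nondecreasing[of c a] by linarith
  show ?thesis using IVT[of ?F a p c] a c isCont_cdf_std_normal \<open>a \<le> c\<close> that by auto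
qed

lemma cdf_std_normal_less_iff:
  "cdf std_normal_distribution x < cdf std_normal_distribution y \<longleftrightarrow> x < y"
  using cdf_std_normal_strict_mono[of x y] cdf_std_normal_strict_mono[of y x]
  by (cases x y rule: linorder_cases) auto

lemma cdf_std_normal_in_unit:
  "0 < cdf std_normal_distribution x" "cdf std_normal_distribution x < 1"
proof -
  interpret N: real_distribution std_normal_distribution by (rule real_dist_normal_dist)
  show "0 < cdf std_normal_distribution x"
    using N.cdf_nonneg[of "x - 1"] cdf_std_normal_strict_mono[of "x - 1" x] by simp
  show "cdf std_normal_distribution x < 1"
    using N.cdf_bounded_prob[of "x + 1"] cdf_std_normal_strict_mono[of x "x + 1"] by simp
qed

text \<open>Polya's theorem for the normal limit, on the grid of quantiles of order \<open>k / m\<close>.\<close>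

lemma cdf_std_normal_uniform_conv:
  fixes F :: "nat \<Rightarrow> real \<Rightarrow> real"
  assumes mono: "\<And>n x y. x \<le> y \<Longrightarrow> F n x \<le> F n y" and F0: "\<And>n x. 0 \<le> F n x" and F1: "\<And>n x. F n x \<le> 1"
    and conv: "\<And>x. (\<lambda>n. F n x) \<longlonglongrightarrow> cdf std_normal_distribution x" and "0 < \<epsilon>"
  shows "\<forall>\<^sub>F n in sequentially. \<forall>x. \<bar>F n x - cdf std_normal_distribution x\<bar> \<le> \<epsilon>"
proof -
  let ?\<Phi> = "cdf std_normal_distribution"
  \<comment> \<open>Two errors of size 1 / m occur: the deviation at a grid point, and the increment
    of the limit over one grid cell.\<close>
  obtain m :: nat where m: "2 / \<epsilon> < real m" using reals_Archimedean2 by blast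
  have "0 < 2 / \<epsilon>" using \<open>0 < \<epsilon>\<close> by simp
  then have m0: "0 < real m" using m by linarith
  have m\<epsilon>: "2 / real m < \<epsilon>" using m m0 \<open>0 < \<epsilon>\<close> by (simp add: field_simps)
  define q where "q k = (SOME x. ?\<Phi> x = real k / real m)" for k
  have q: "?\<Phi> (q k) = real k / real m" if "1 \<le> k" "k < m" for k
  proof -
    have "0 < real k / real m" "real k / real m < 1" using that by auto
    then obtain x where "?\<Phi> x = real k / real m" by (rule cdf_std_normal_quantile)
    then show ?thesis unfolding q_def by (rule someI)
  qed
  have "\<forall>\<^sub>F n in sequentially. \<forall>k\<in>{1..<m}. \<bar>F n (q k) - ?\<Phi> (q k)\<bar> < 1 / real m"
  proof (rule eventually_ball_finite)
    show "\<forall>k\<in>{1..<m}. \<forall>\<^sub>F n in sequentially. \<bar>F n (q k) - ?\<Phi> (q k)\<bar> < 1 / real m"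
      using conv m0 by (auto simp: tendsto_iff dist_real_def)
  qed simp
  then show ?thesis
  proof eventually_elim
    case (elim n)
    show ?case
    proof
      fix x
      \<comment> \<open>This is the cell of x: the normal cdf at x lies between \<open>k / m\<close>
        and \<open>(k + 1) / m\<close>. In the two extreme cells a bounding quantile is missing,
        because the levels 0 and 1 are not attained; there the trivial bounds 0 and 1 for
        \<open>F n x\<close> take its place.\<close>
      define k where "k = nat \<lfloor>real m * ?\<Phi> x\<rfloor>"
      have pos: "0 \<le> real m * ?\<Phi> x" using cdf_std_normal_in_unit(1)[of x] m0 by simp
      have k: "real k \<le> real m * ?\<Phi> x" "real m * ?\<Phi> x < real k + 1"
        unfolding k_def using pos by linarith+
      have "real m * ?\<Phi> x < real m" using cdf_std_normal_in_unit(2)[of x] m0 by simp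
      then have km: "k < m" using k by simp
      have k': "real k / real m \<le> ?\<Phi> x" "?\<Phi> x < real k / real m + 1 / real m"
        using k m0 by (simp_all add: field_simps)
      have "?\<Phi> x - 2 / real m \<le> F n x"
      proof (cases "k = 0")
        case True
        have "1 / real m \<le> 2 / real m" by (simp add: divide_right_mono)
        then show ?thesis using True k' F0[of n x] by simp
      next
        case False
        then have "?\<Phi> (q k) \<le> ?\<Phi> x" using q[of k] km k' by simp
        then have "F n (q k) \<le> F n x" using cdf_std_normal_less_iff[of x "q k"] by (intro mono) simp
        moreover have "\<bar>F n (q k) - ?\<Phi> (q k)\<bar> < 1 / real m" using elim False km by simp
        moreover have "2 / real m = 1 / real m + 1 / real m" by simp
        moreover have "?\<Phi> (q k) = real k / real m" using q False km by simp
        ultimately show ?thesis using k'(2) by linarith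
      qed
      moreover have "F n x \<le> ?\<Phi> x + 2 / real m"
      proof (cases "k + 1 = m")
        case True
        then have "1 \<le> ?\<Phi> x + 1 / real m" using k'(1) m0 by (auto simp: field_simps)
        moreover have "1 / real m \<le> 2 / real m" by (simp add: divide_right_mono)
        ultimately show ?thesis using F1[of n x] by simp
      next
        case False
        then have k1: "1 \<le> k + 1" "k + 1 < m" using km by auto
        then have "?\<Phi> x \<le> ?\<Phi> (q (k + 1))" using q[OF k1] k'(2) by (simp add: add_divide_distrib)
        then have "F n x \<le> F n (q (k + 1))"
          using cdf_std_normal_less_iff[of "q (k + 1)" x] by (intro mono) simp
        moreover have "\<bar>F n (q (k + 1)) - ?\<Phi> (q (k + 1))\<bar> < 1 / real m" using elim k1 by simp
        ultimately show ?thesis using q[OF k1] k' by (simp add: add_divide_distrib)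
      qed
      ultimately show "\<bar>F n x - ?\<Phi> x\<bar> \<le> \<epsilon>" using m\<epsilon> by linarith
    qed
  qed
qed

section \<open>Quadratic forms in Gaussian noise\<close>

text \<open>Serves to drop the noise variable of index 0 and renumber the others from 0. Injectivity
  lets events indexed by J be carried to the image of J through \<open>inv_into\<close>, where the
  product formula is known.\<close>

lemma (in prob_space) indep_vars_reindex_inj:
  assumes inj: "inj_on f I" and indep: "indep_vars M' X (f ` I)"
  shows "indep_vars (\<lambda>i. M' (f i)) (\<lambda>i. X (f i)) I"
proof -
  let ?E = "\<lambda>i. {X i -` A \<inter> space M |A. A \<in> sets (M' i)}"
  have E: "indep_sets ?E (f ` I)" using indep by (simp add: indep_vars_def2)
  have "indep_sets (\<lambda>i. ?E (f i)) I"
  proof (rule indep_setsI)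
    show "?E (f i) \<subseteq> events" if "i \<in> I" for i
      using E that unfolding indep_sets_def by blast
  next
    fix A J
    assume J: "J \<noteq> {}" "J \<subseteq> I" "finite J" and A: "\<forall>j\<in>J. A j \<in> ?E (f j)"
    define B where "B k = A (inv_into I f k)" for k
    have B: "B (f j) = A j" if "j \<in> J" for j
      using inj J(2) that by (simp add: B_def inv_into_f_f subset_iff)
    have "prob (\<Inter>k\<in>f ` J. B k) = (\<Prod>k\<in>f ` J. prob (B k))"
      using J A B by (intro indep_setsD[OF E]) auto
    also have "\<dots> = (\<Prod>j\<in>J. prob (B (f j)))"
      using inj_on_subset[OF inj J(2)] by (simp add: prod.reindex)
    finally show "prob (\<Inter>j\<in>J. A j) = (\<Prod>j\<in>J. prob (A j))"
      using B by (simp cong: INF_cong prod.cong)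
  qed
  then show ?thesis using indep by (simp add: indep_vars_def2)
qed

lemma enn2real_suminf_ennreal:
  assumes "\<And>j. 0 \<le> f j" "summable f"
  shows "enn2real (\<Sum>j. ennreal (f j)) = (\<Sum>j. f j)"
  using assms by (simp add: suminf_ennreal2 suminf_nonneg)

section \<open>Moments of the Gaussian noise and of its centred squares\<close>

locale gaussian_noise = prob_space +
  fixes \<xi> :: "nat \<Rightarrow> 'a \<Rightarrow> real"
  assumes indep: "indep_vars (\<lambda>_. borel) \<xi> UNIV"
    and gauss: "\<And>j. distributed M lborel (\<xi> j) std_normal_density"
begin

lemma noise_measurable [measurable]: "\<xi> j \<in> borel_measurable M"
  using indep unfolding indep_vars_def2 by simp

lemma noise_moment_integrable: "integrable M (\<lambda>\<omega>. \<xi> j \<omega> ^ k)"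
  using integrable_std_normal_moment[of k]
    distributed_integrable[OF gauss, of "\<lambda>x. x ^ k" j] by simp

lemma noise_even_moment: "expectation (\<lambda>\<omega>. \<xi> j \<omega> ^ (2 * k)) = fact (2 * k) / (2 ^ k * fact k)"
  using integral_std_normal_moment_even[of k]
    distributed_integral[OF gauss, of "\<lambda>x. x ^ (2 * k)" j] by simp

lemma noise_mean: "expectation (\<xi> j) = 0"
  using standard_normal_distributed_expectation[OF gauss] .

lemma noise_square: "expectation (\<lambda>\<omega>. (\<xi> j \<omega>)\<^sup>2) = 1"
  using noise_even_moment[of j 1] by (simp add: fact_numeral)

lemma noise_fourth: "expectation (\<lambda>\<omega>. (\<xi> j \<omega>) ^ 4) = 3"
  using noise_even_moment[of j 2] by (simp add: fact_numeral)

text \<open>The centred chi-square variable with one degree of freedom; weighted sums of these make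
  up the statistic when no signal is present.\<close>

definition chi :: "nat \<Rightarrow> 'a \<Rightarrow> real" where "chi j \<omega> = (\<xi> j \<omega>)\<^sup>2 - 1"

lemma chi_measurable [measurable]: "chi j \<in> borel_measurable M"
  unfolding chi_def by measurable

lemma chi_mean: "integrable M (chi j)" "expectation (chi j) = 0"
  using noise_moment_integrable[of j 2] noise_square[of j] prob_space
  unfolding chi_def by auto

lemma chi_square: "integrable M (\<lambda>\<omega>. (chi j \<omega>)\<^sup>2)" "expectation (\<lambda>\<omega>. (chi j \<omega>)\<^sup>2) = 2"
proof -
  have *: "(chi j \<omega>)\<^sup>2 = \<xi> j \<omega> ^ 4 - 2 * (\<xi> j \<omega>)\<^sup>2 + 1" for \<omega>
    by (simp add: chi_def power2_eq_square algebra_simps numeral_eq_Suc)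
  show "integrable M (\<lambda>\<omega>. (chi j \<omega>)\<^sup>2)" "expectation (\<lambda>\<omega>. (chi j \<omega>)\<^sup>2) = 2"
    unfolding * using noise_moment_integrable[of j 2] noise_moment_integrable[of j 4]
      noise_square[of j] noise_fourth[of j] prob_space by auto
qed

text \<open>Since |\<xi>^2 - 1| is at most \<xi>^2 + 1, the cube can be expanded; the moments of
  orders 6, 4 and 2 are 15, 3 and 1, which gives 15 + 3 * 3 + 3 * 1 + 1 = 28.\<close>

lemma chi_cube:
  "integrable M (\<lambda>\<omega>. \<bar>chi j \<omega>\<bar> ^ 3)" "expectation (\<lambda>\<omega>. \<bar>chi j \<omega>\<bar> ^ 3) \<le> 28"
proof -
  have le: "\<bar>chi j \<omega>\<bar> ^ 3 \<le> \<xi> j \<omega> ^ 6 + 3 * \<xi> j \<omega> ^ 4 + 3 * (\<xi> j \<omega>)\<^sup>2 + 1" for \<omega>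
  proof -
    have "\<bar>chi j \<omega>\<bar> \<le> (\<xi> j \<omega>)\<^sup>2 + 1" by (simp add: chi_def abs_le_iff)
    then have "\<bar>chi j \<omega>\<bar> ^ 3 \<le> ((\<xi> j \<omega>)\<^sup>2 + 1) ^ 3" by (intro power_mono) auto
    also have "\<dots> = \<xi> j \<omega> ^ 6 + 3 * \<xi> j \<omega> ^ 4 + 3 * (\<xi> j \<omega>)\<^sup>2 + 1"
      by (simp add: power2_eq_square algebra_simps numeral_eq_Suc)
    finally show ?thesis .
  qed
  have int: "integrable M (\<lambda>\<omega>. \<xi> j \<omega> ^ 6 + 3 * \<xi> j \<omega> ^ 4 + 3 * (\<xi> j \<omega>)\<^sup>2 + 1)"
    using noise_moment_integrable[of j 2] noise_moment_integrable[of j 4]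
      noise_moment_integrable[of j 6] by auto
  show "integrable M (\<lambda>\<omega>. \<bar>chi j \<omega>\<bar> ^ 3)"
    by (rule Bochner_Integration.integrable_bound[OF int]) (use le in \<open>auto intro!: AE_I2 order_trans[OF le]\<close>)
  then have "expectation (\<lambda>\<omega>. \<bar>chi j \<omega>\<bar> ^ 3) \<le>
      expectation (\<lambda>\<omega>. \<xi> j \<omega> ^ 6 + 3 * \<xi> j \<omega> ^ 4 + 3 * (\<xi> j \<omega>)\<^sup>2 + 1)"
    using int le by (intro integral_mono) auto
  also have "\<dots> = 28"
    using noise_moment_integrable[of j 2] noise_moment_integrable[of j 4]
      noise_moment_integrable[of j 6] noise_square[of j] noise_fourth[of j]
      noise_even_moment[of j 3] prob_space by (simp add: fact_numeral)
  finally show "expectation (\<lambda>\<omega>. \<bar>chi j \<omega>\<bar> ^ 3) \<le> 28" .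
qed

section \<open>Characteristic functions and asymptotic normality under the null\<close>

lemma char_weighted_chi:
  assumes "0 \<le> w"
  shows "cmod (char (distr M borel (\<lambda>\<omega>. w * chi j \<omega>)) t - exp (- (t\<^sup>2 * w\<^sup>2)))
    \<le> 5 * \<bar>t\<bar> ^ 3 * w ^ 3 + t ^ 4 * w ^ 4"
proof -
  \<comment> \<open>With mean 0 and this variance, the second order expansion of the characteristic
    function is 1 - t^2 w^2; the remainder is controlled by the third absolute moment.\<close>
  have var: "variance (\<lambda>\<omega>. w * chi j \<omega>) = 2 * w\<^sup>2"
    using chi_mean[of j] chi_square[of j] by (simp add: power_mult_distrib)
  have "cmod (char (distr M borel (\<lambda>\<omega>. w * chi j \<omega>)) t - (1 - t\<^sup>2 * (2 * w\<^sup>2) / 2))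
      \<le> t\<^sup>2 / 6 * expectation (\<lambda>\<omega>. min (6 * (w * chi j \<omega>)\<^sup>2) (\<bar>t\<bar> * \<bar>w * chi j \<omega>\<bar> ^ 3))"
    using chi_mean[of j] chi_square[of j] var
    by (intro char_approx3') (auto simp: power_mult_distrib)
  also have "\<dots> \<le> t\<^sup>2 / 6 * expectation (\<lambda>\<omega>. \<bar>t\<bar> * w ^ 3 * \<bar>chi j \<omega>\<bar> ^ 3)"
  proof (intro mult_left_mono integral_mono)
    have "integrable M (\<lambda>\<omega>. 6 * (w * chi j \<omega>)\<^sup>2)" "integrable M (\<lambda>\<omega>. \<bar>t\<bar> * \<bar>w * chi j \<omega>\<bar> ^ 3)"
      using chi_square[of j] chi_cube[of j] by (auto simp: power_mult_distrib abs_mult)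
    then show "integrable M (\<lambda>\<omega>. min (6 * (w * chi j \<omega>)\<^sup>2) (\<bar>t\<bar> * \<bar>w * chi j \<omega>\<bar> ^ 3))"
      by auto
    show "integrable M (\<lambda>\<omega>. \<bar>t\<bar> * w ^ 3 * \<bar>chi j \<omega>\<bar> ^ 3)" using chi_cube[of j] by auto
  qed (use assms in \<open>auto simp: abs_mult power_mult_distrib min_le_iff_disj\<close>)
  also have "\<dots> = \<bar>t\<bar> ^ 3 * w ^ 3 * (expectation (\<lambda>\<omega>. \<bar>chi j \<omega>\<bar> ^ 3) / 6)"
    by (simp add: power3_eq_cube power2_eq_square)
  \<comment> \<open>The constant 5 is an upper bound for 28 / 6.\<close>
  also have "\<dots> \<le> \<bar>t\<bar> ^ 3 * w ^ 3 * 5"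
    using chi_cube(2)[of j] assms by (intro mult_left_mono) auto
  finally have 1: "cmod (char (distr M borel (\<lambda>\<omega>. w * chi j \<omega>)) t - (1 - t\<^sup>2 * w\<^sup>2)) \<le> 5 * \<bar>t\<bar> ^ 3 * w ^ 3"
    by (simp add: algebra_simps)
  \<comment> \<open>Used with u = t^2 w^2 to replace the quadratic polynomial by the Gaussian
    factor.\<close>
  have exp_bound: "\<bar>exp (-u) - (1 - u)\<bar> \<le> u\<^sup>2" if "0 \<le> u" for u :: real
  proof -
    have "1 - u \<le> exp (-u)" using exp_ge_add_one_self[of "-u"] by simp
    moreover have "exp (-u) \<le> 1 - u + u\<^sup>2"
    proof -
      \<comment> \<open>The product equals 1 + u^3.\<close>
      have "1 \<le> (1 - u + u\<^sup>2) * (1 + u)" using that by (simp add: power2_eq_square algebra_simps)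
      also have "\<dots> \<le> (1 - u + u\<^sup>2) * exp u"
      proof (rule mult_left_mono)
        have "0 \<le> (1 - u)\<^sup>2 + u" using that by simp
        then show "0 \<le> 1 - u + u\<^sup>2" using that by (simp add: power2_diff)
      qed (use exp_ge_add_one_self[of u] in simp)
      finally show ?thesis by (simp add: exp_minus field_simps)
    qed
    ultimately show ?thesis by simp
  qed
  have "cmod (complex_of_real (1 - t\<^sup>2 * w\<^sup>2) - exp (- (t\<^sup>2 * w\<^sup>2))) = \<bar>exp (-(t\<^sup>2 * w\<^sup>2)) - (1 - t\<^sup>2 * w\<^sup>2)\<bar>"
    by (metis abs_minus_commute norm_of_real of_real_diff)
  also have "\<dots> \<le> t ^ 4 * w ^ 4"
    using exp_bound[of "t\<^sup>2 * w\<^sup>2"] by (simp add: power_mult_distrib flip: power_mult)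
  finally have 2: "cmod (complex_of_real (1 - t\<^sup>2 * w\<^sup>2) - exp (- (t\<^sup>2 * w\<^sup>2))) \<le> t ^ 4 * w ^ 4" .
  have "cmod (char (distr M borel (\<lambda>\<omega>. w * chi j \<omega>)) t - exp (- (t\<^sup>2 * w\<^sup>2)))
    \<le> cmod (char (distr M borel (\<lambda>\<omega>. w * chi j \<omega>)) t - (1 - t\<^sup>2 * w\<^sup>2))
     + cmod (complex_of_real (1 - t\<^sup>2 * w\<^sup>2) - exp (- (t\<^sup>2 * w\<^sup>2)))"
    using norm_triangle_ineq[of "char (distr M borel (\<lambda>\<omega>. w * chi j \<omega>)) t - (1 - t\<^sup>2 * w\<^sup>2)"
      "complex_of_real (1 - t\<^sup>2 * w\<^sup>2) - exp (- (t\<^sup>2 * w\<^sup>2))"] by simp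
  with 1 2 show ?thesis by simp
qed

text \<open>On a divergent sum \<^const>\<open>enn2real\<close> gives 0, the same junk value as \<^const>\<open>infsum\<close>, and it makes
  measurability immediate.\<close>

definition quad :: "(nat \<Rightarrow> real) \<Rightarrow> (nat \<Rightarrow> real) \<Rightarrow> 'a \<Rightarrow> real" where
  "quad w h \<omega> = enn2real (\<Sum>j. ennreal (w j * (h j + \<xi> j \<omega>)\<^sup>2)) - (\<Sum>j. w j)"

lemma quad_measurable [measurable]: "quad w h \<in> borel_measurable M"
  unfolding quad_def by measurable

text \<open>By monotone convergence the series has expectation equal to the sum of the weights,
  which is finite.\<close>

lemma AE_summable_noise:
  assumes "\<And>j. 0 \<le> w j" "summable w"
  shows "AE \<omega> in M. summable (\<lambda>j. w j * (\<xi> j \<omega>)\<^sup>2)"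
proof -
  have one: "(\<integral>\<^sup>+\<omega>. ennreal (w j * (\<xi> j \<omega>)\<^sup>2) \<partial>M) = ennreal (w j)" for j
    using noise_moment_integrable[of j 2] noise_square[of j] assms(1)
    by (subst nn_integral_eq_integral) auto
  have "(\<integral>\<^sup>+\<omega>. (\<Sum>j. ennreal (w j * (\<xi> j \<omega>)\<^sup>2)) \<partial>M) = (\<Sum>j. ennreal (w j))"
    by (subst nn_integral_suminf) (auto simp: one)
  also have "\<dots> \<noteq> \<infinity>"
    unfolding infinity_ennreal_def by (rule ennreal_suminf_neq_top) fact+
  finally have "AE \<omega> in M. (\<Sum>j. ennreal (w j * (\<xi> j \<omega>)\<^sup>2)) \<noteq> \<infinity>"
    by (intro nn_integral_PInf_AE) auto
  then show ?thesis
    using assms(1) by (auto elim!: eventually_mono intro: summable_suminf_not_top)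
qed

lemma quad_zero_sums:
  assumes "\<And>j. 0 \<le> w j" "summable w" "summable (\<lambda>j. w j * (\<xi> j \<omega>)\<^sup>2)"
  shows "(\<lambda>j. w j * chi j \<omega>) sums quad w (\<lambda>_. 0) \<omega>"
proof -
  have eq: "w j * chi j \<omega> = w j * (\<xi> j \<omega>)\<^sup>2 - w j" for j
    by (simp add: chi_def algebra_simps)
  have "(\<lambda>j. w j * chi j \<omega>) sums ((\<Sum>j. w j * (\<xi> j \<omega>)\<^sup>2) - (\<Sum>j. w j))"
    unfolding eq using assms(2,3) by (intro sums_diff summable_sums)
  moreover have "enn2real (\<Sum>j. ennreal (w j * (\<xi> j \<omega>)\<^sup>2)) = (\<Sum>j. w j * (\<xi> j \<omega>)\<^sup>2)"
    by (rule enn2real_suminf_ennreal[OF _ assms(3)]) (simp add: assms(1))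
  ultimately show ?thesis by (simp only: quad_def add_0)
qed

text \<open>For a partial sum, independence gives a product of characteristic functions. All factors
  have modulus at most 1, so replacing them by Gaussian ones costs at most the sum of the individual
  errors, and w^3 \<le> b w^2, w^4 \<le> b^2 w^2 reduce that sum to the sum of w^2. Dominated
  convergence passes to the infinite series. Squared weights adding up to 1/2 mean unit variance,
  because each \<open>chi j\<close> has variance 2.\<close>

lemma char_quad_bound:
  assumes w: "\<And>j. 0 \<le> w j" "summable w" and b: "\<And>j. w j \<le> b"
    and norm: "(\<lambda>j. (w j)\<^sup>2) sums (1/2)"
  shows "cmod (char (distr M borel (quad w (\<lambda>_. 0))) t - exp (- (t\<^sup>2) / 2)) \<le> 5 * \<bar>t\<bar> ^ 3 * b + t ^ 4 * b\<^sup>2"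
proof -
  let ?S = "\<lambda>m \<omega>. \<Sum>j<m. w j * chi j \<omega>"
  have b0: "0 \<le> b" using w(1)[of 0] b[of 0] by simp
  have chard: "char (distr M borel X) t = (CLINT \<omega>|M. iexp (t * X \<omega>))"
    if [measurable]: "X \<in> borel_measurable M" for X
    by (simp add: char_def integral_distr)
  have lim1: "(\<lambda>m. char (distr M borel (?S m)) t) \<longlonglongrightarrow> char (distr M borel (quad w (\<lambda>_. 0))) t"
    unfolding chard[OF quad_measurable]
  proof (subst chard)
    show "(\<lambda>m. CLINT \<omega>|M. iexp (t * ?S m \<omega>)) \<longlonglongrightarrow> (CLINT \<omega>|M. iexp (t * quad w (\<lambda>_. 0) \<omega>))"
    proof (rule integral_dominated_convergence[where w="\<lambda>_. 1"])
      show "AE \<omega> in M. (\<lambda>m. iexp (t * ?S m \<omega>)) \<longlonglongrightarrow> iexp (t * quad w (\<lambda>_. 0) \<omega>)"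
        using AE_summable_noise[OF w]
      proof eventually_elim
        case (elim \<omega>)
        then have "(\<lambda>m. ?S m \<omega>) \<longlonglongrightarrow> quad w (\<lambda>_. 0) \<omega>"
          using quad_zero_sums[OF w] by (simp add: sums_def)
        then show ?case by (intro tendsto_intros)
      qed
    qed auto
  qed auto
  have lim2: "(\<lambda>m. complex_of_real (exp (- (t\<^sup>2 * (\<Sum>j<m. (w j)\<^sup>2))))) \<longlonglongrightarrow> exp (- (t\<^sup>2) / 2)"
  proof -
    have "(\<lambda>m. \<Sum>j<m. (w j)\<^sup>2) \<longlonglongrightarrow> 1/2" using norm by (simp add: sums_def)
    then have "(\<lambda>m. complex_of_real (exp (- (t\<^sup>2 * (\<Sum>j<m. (w j)\<^sup>2))))) \<longlonglongrightarrow> exp (- (t\<^sup>2 * (1/2)))"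
      by (intro tendsto_intros)
    then show ?thesis by simp
  qed
  have bound: "cmod (char (distr M borel (?S m)) t - exp (- (t\<^sup>2 * (\<Sum>j<m. (w j)\<^sup>2))))
      \<le> 5 * \<bar>t\<bar> ^ 3 * b + t ^ 4 * b\<^sup>2" for m
  proof -
    have "char (distr M borel (?S m)) t = (\<Prod>j<m. char (distr M borel (\<lambda>\<omega>. w j * chi j \<omega>)) t)"
      unfolding chi_def
      by (rule char_distr_sum, rule indep_vars_compose2[where X=\<xi>], rule indep_vars_subset[OF indep]) auto
    moreover have "complex_of_real (exp (- (t\<^sup>2 * (\<Sum>j<m. (w j)\<^sup>2)))) = (\<Prod>j<m. complex_of_real (exp (- (t\<^sup>2 * (w j)\<^sup>2))))"
      by (simp add: exp_sum[symmetric] sum_distrib_left sum_negf of_real_prod[symmetric] del: of_real_prod)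
    ultimately have "cmod (char (distr M borel (?S m)) t - exp (- (t\<^sup>2 * (\<Sum>j<m. (w j)\<^sup>2))))
      = cmod ((\<Prod>j<m. char (distr M borel (\<lambda>\<omega>. w j * chi j \<omega>)) t) - (\<Prod>j<m. complex_of_real (exp (- (t\<^sup>2 * (w j)\<^sup>2)))))"
      by simp
    also have "\<dots> \<le> (\<Sum>j<m. cmod (char (distr M borel (\<lambda>\<omega>. w j * chi j \<omega>)) t - complex_of_real (exp (- (t\<^sup>2 * (w j)\<^sup>2)))))"
    proof (rule norm_prod_diff)
      show "cmod (char (distr M borel (\<lambda>\<omega>. w j * chi j \<omega>)) t) \<le> 1" for j
        by (intro real_distribution.cmod_char_le_1 real_distribution_distr) auto
    qed (simp del: of_real_exp)
    also have "\<dots> \<le> (\<Sum>j<m. (5 * \<bar>t\<bar> ^ 3 * b + t ^ 4 * b\<^sup>2) * (w j)\<^sup>2)"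
    proof (rule sum_mono)
      fix j
      have "w j ^ 3 \<le> b * (w j)\<^sup>2" 
        using mult_right_mono[OF b[of j], of "(w j)\<^sup>2"] by (simp add: power3_eq_cube power2_eq_square)
      then have 3: "5 * \<bar>t\<bar> ^ 3 * w j ^ 3 \<le> 5 * \<bar>t\<bar> ^ 3 * (b * (w j)\<^sup>2)" by (intro mult_left_mono) auto
      have "(w j)\<^sup>2 * (w j)\<^sup>2 \<le> b\<^sup>2 * (w j)\<^sup>2"
        using b[of j] w(1)[of j] by (intro mult_right_mono power_mono) auto
      then have "w j ^ 4 \<le> b\<^sup>2 * (w j)\<^sup>2" by (simp flip: power_add)
      then have 4: "t ^ 4 * w j ^ 4 \<le> t ^ 4 * (b\<^sup>2 * (w j)\<^sup>2)" by (intro mult_left_mono) auto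
      show "cmod (char (distr M borel (\<lambda>\<omega>. w j * chi j \<omega>)) t - complex_of_real (exp (- (t\<^sup>2 * (w j)\<^sup>2))))
        \<le> (5 * \<bar>t\<bar> ^ 3 * b + t ^ 4 * b\<^sup>2) * (w j)\<^sup>2"
        using char_weighted_chi[OF w(1), of j j t] 3 4 by (simp add: algebra_simps)
    qed
    also have "\<dots> = (5 * \<bar>t\<bar> ^ 3 * b + t ^ 4 * b\<^sup>2) * (\<Sum>j<m. (w j)\<^sup>2)"
      by (simp add: sum_distrib_left)
    also have "\<dots> \<le> (5 * \<bar>t\<bar> ^ 3 * b + t ^ 4 * b\<^sup>2) * 1"
    proof (rule mult_left_mono)
      have "(\<Sum>j<m. (w j)\<^sup>2) \<le> 1/2"
        using norm sum_le_suminf[of "\<lambda>j. (w j)\<^sup>2" "{..<m}"] by (auto simp: sums_iff)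
      then show "(\<Sum>j<m. (w j)\<^sup>2) \<le> 1" by simp
    qed (use b0 in simp)
    finally show ?thesis by simp
  qed
  have "(\<lambda>m. cmod (char (distr M borel (?S m)) t - exp (- (t\<^sup>2 * (\<Sum>j<m. (w j)\<^sup>2)))))
      \<longlonglongrightarrow> cmod (char (distr M borel (quad w (\<lambda>_. 0))) t - exp (- (t\<^sup>2) / 2))"
    by (intro tendsto_norm tendsto_diff lim1 lim2)
  then show ?thesis by (rule LIMSEQ_le_const2) (use bound in blast)
qed

definition quad_cdf :: "(nat \<Rightarrow> real) \<Rightarrow> (nat \<Rightarrow> real) \<Rightarrow> real \<Rightarrow> real" where
  "quad_cdf w h x = prob {\<omega> \<in> space M. quad w h \<omega> \<le> x}"

text \<open>The error in \<open>char_quad_bound\<close> vanishes at each t together with the largest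
  weight, so Levy's continuity theorem applies; convergence of the cdf holds everywhere because the
  limit is continuous.\<close>

lemma quad_clt:
  assumes w: "\<And>n j. 0 \<le> w n j" "\<And>n. summable (w n)" and b: "\<And>n j. w n j \<le> b n"
    and norm: "\<And>n. (\<lambda>j. (w n j)\<^sup>2) sums (1/2)" and b0: "b \<longlonglongrightarrow> 0"
  shows "(\<lambda>n. quad_cdf (w n) (\<lambda>_. 0) x) \<longlonglongrightarrow> cdf std_normal_distribution x"
proof -
  interpret N: real_distribution std_normal_distribution by (rule real_dist_normal_dist)
  have "weak_conv_m (\<lambda>n. distr M borel (quad (w n) (\<lambda>_. 0))) std_normal_distribution"
  proof (rule levy_continuity)
    fix t
    have "(\<lambda>n. 5 * \<bar>t\<bar> ^ 3 * b n + t ^ 4 * (b n)\<^sup>2) \<longlonglongrightarrow> 5 * \<bar>t\<bar> ^ 3 * 0 + t ^ 4 * 0\<^sup>2"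
      by (intro tendsto_intros b0)
    then have lim: "(\<lambda>n. 5 * \<bar>t\<bar> ^ 3 * b n + t ^ 4 * (b n)\<^sup>2) \<longlonglongrightarrow> 0" by simp
    have "(\<lambda>n. char (distr M borel (quad (w n) (\<lambda>_. 0))) t - exp (- (t\<^sup>2) / 2)) \<longlonglongrightarrow> 0"
      using char_quad_bound[OF w b norm] by (intro Lim_null_comparison[OF always_eventually lim]) blast
    then show "(\<lambda>n. char (distr M borel (quad (w n) (\<lambda>_. 0))) t) \<longlonglongrightarrow> char std_normal_distribution t"
      by (subst Lim_null) (simp add: char_std_normal_distribution)
  qed (auto intro!: real_dist_normal_dist)
  moreover have "isCont (cdf std_normal_distribution) x"
    by (rule isCont_cdf_std_normal)
  ultimately have "(\<lambda>n. cdf (distr M borel (quad (w n) (\<lambda>_. 0))) x) \<longlonglongrightarrow> cdf std_normal_distribution x"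
    by (simp add: weak_conv_m_def weak_conv_def)
  moreover have "cdf (distr M borel (quad (w n) (\<lambda>_. 0))) x = quad_cdf (w n) (\<lambda>_. 0) x" for n
    by (auto simp: cdf_def quad_cdf_def measure_distr intro!: arg_cong[where f=prob])
  ultimately show ?thesis by simp
qed

section \<open>The linear term caused by a signal\<close>

lemma noise_inner: "expectation (\<lambda>\<omega>. \<xi> j \<omega> * \<xi> k \<omega>) = (if j = k then 1 else 0)"
  "integrable M (\<lambda>\<omega>. \<xi> j \<omega> * \<xi> k \<omega>)"
proof -
  have int: "integrable M (\<xi> i)" for i using noise_moment_integrable[of i 1] by simp
  have ind: "indep_vars (\<lambda>_. borel) \<xi> {j, k}"
    by (rule indep_vars_subset[OF indep]) simp
  have "expectation (\<lambda>\<omega>. \<xi> j \<omega> * \<xi> k \<omega>) = (if j = k then 1 else 0) \<and>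
    integrable M (\<lambda>\<omega>. \<xi> j \<omega> * \<xi> k \<omega>)"
  proof (cases "j = k")
    case True
    then show ?thesis
      using noise_square[of k] noise_moment_integrable[of k 2] by (simp add: power2_eq_square)
  next
    case False
    have "expectation (\<lambda>\<omega>. \<Prod>i\<in>{j, k}. \<xi> i \<omega>) = (\<Prod>i\<in>{j, k}. expectation (\<xi> i))"
      by (rule indep_vars_lebesgue_integral[OF _ ind int]) simp
    moreover have "integrable M (\<lambda>\<omega>. \<Prod>i\<in>{j, k}. \<xi> i \<omega>)"
      by (rule indep_vars_integrable[OF _ ind int]) simp
    ultimately show ?thesis using False noise_mean by simp
  qed
  then show "expectation (\<lambda>\<omega>. \<xi> j \<omega> * \<xi> k \<omega>) = (if j = k then 1 else 0)"
    "integrable M (\<lambda>\<omega>. \<xi> j \<omega> * \<xi> k \<omega>)" by simp_all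
qed

text \<open>Chebyshev's inequality. The second moment of the almost sure limit is bounded by Fatou's
  lemma through those of the partial sums, where orthonormality of the noise removes the cross
  terms.\<close>

lemma linear_form_tail:
  assumes c: "summable (\<lambda>j. (c j)\<^sup>2)" and conv: "AE \<omega> in M. (\<lambda>j. c j * \<xi> j \<omega>) sums L \<omega>"
    and [measurable]: "L \<in> borel_measurable M" and "0 < \<eta>"
  shows "prob {\<omega> \<in> space M. \<eta> \<le> \<bar>L \<omega>\<bar>} \<le> (\<Sum>j. (c j)\<^sup>2) / \<eta>\<^sup>2"
proof -
  let ?S = "\<lambda>m \<omega>. \<Sum>j<m. c j * \<xi> j \<omega>"
  have S2: "(\<integral>\<^sup>+\<omega>. ennreal ((?S m \<omega>)\<^sup>2) \<partial>M) = ennreal (\<Sum>j<m. (c j)\<^sup>2)" for m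
  proof -
    have eq: "(?S m \<omega>)\<^sup>2 = (\<Sum>j<m. \<Sum>k<m. (c j * c k) * (\<xi> j \<omega> * \<xi> k \<omega>))" for \<omega>
      by (simp add: power2_eq_square sum_product algebra_simps)
    have "integrable M (\<lambda>\<omega>. (?S m \<omega>)\<^sup>2)"
      unfolding eq by (intro Bochner_Integration.integrable_sum integrable_mult_right noise_inner)
    moreover have "expectation (\<lambda>\<omega>. (?S m \<omega>)\<^sup>2) = (\<Sum>j<m. (c j)\<^sup>2)"
      unfolding eq
      by (simp add: Bochner_Integration.integral_sum Bochner_Integration.integrable_sum noise_inner
          power2_eq_square if_distrib[where f="\<lambda>z. _ * z"] cong: if_cong)
    ultimately show ?thesis by (subst nn_integral_eq_integral) auto
  qed
  have "(\<integral>\<^sup>+\<omega>. ennreal ((L \<omega>)\<^sup>2) \<partial>M) = (\<integral>\<^sup>+\<omega>. liminf (\<lambda>m. ennreal ((?S m \<omega>)\<^sup>2)) \<partial>M)"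
  proof (rule nn_integral_cong_AE, use conv in eventually_elim)
    case (elim \<omega>)
    then have "(\<lambda>m. ennreal ((?S m \<omega>)\<^sup>2)) \<longlonglongrightarrow> ennreal ((L \<omega>)\<^sup>2)"
      by (intro tendsto_intros) (simp add: sums_def)
    then show ?case by (rule lim_imp_Liminf[OF trivial_limit_sequentially, symmetric])
  qed
  also have "\<dots> \<le> liminf (\<lambda>m. \<integral>\<^sup>+\<omega>. ennreal ((?S m \<omega>)\<^sup>2) \<partial>M)"
    by (rule nn_integral_liminf) measurable
  also have "\<dots> \<le> ennreal (\<Sum>j. (c j)\<^sup>2)"
    unfolding S2 using sum_le_suminf[OF c] by (intro Liminf_le always_eventually allI ennreal_leI) auto
  finally have L2: "(\<integral>\<^sup>+\<omega>. ennreal ((L \<omega>)\<^sup>2) \<partial>M) \<le> ennreal (\<Sum>j. (c j)\<^sup>2)" .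
  then have int: "integrable M (\<lambda>\<omega>. (L \<omega>)\<^sup>2)"
    by (intro integrableI_bounded) (auto intro: le_less_trans[OF _ ennreal_less_top])
  have "expectation (\<lambda>\<omega>. (L \<omega>)\<^sup>2) \<le> (\<Sum>j. (c j)\<^sup>2)"
    using L2 by (subst (asm) nn_integral_eq_integral[OF int]) (auto simp: ennreal_le_iff suminf_nonneg c)
  moreover have "prob {\<omega> \<in> space M. \<eta>\<^sup>2 \<le> (L \<omega>)\<^sup>2} \<le> expectation (\<lambda>\<omega>. (L \<omega>)\<^sup>2) / \<eta>\<^sup>2"
    using \<open>0 < \<eta>\<close> by (intro integral_Markov_inequality_measure[where A="{}"] int) auto
  moreover have "\<eta>\<^sup>2 \<le> (L \<omega>)\<^sup>2 \<longleftrightarrow> \<eta> \<le> \<bar>L \<omega>\<bar>" for \<omega>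
    using \<open>0 < \<eta>\<close> by (metis abs_le_square_iff abs_of_pos)
  ultimately show ?thesis
    using divide_right_mono[of "expectation (\<lambda>\<omega>. (L \<omega>)\<^sup>2)" "\<Sum>j. (c j)\<^sup>2" "\<eta>\<^sup>2"] by simp
qed

text \<open>Expanding the square, the signal adds the constant \<mu> and the linear form L with
  coefficients 2 w h. The sum of the squared coefficients is at most 4 b \<mu>, so up to the
  probability 4 b \<mu> / \<eta>^2 that L is not below \<eta> in modulus, the signal amounts to
  moving the threshold by \<mu>, with tolerance \<eta>.\<close>

lemma quad_cdf_shift:
  assumes w: "\<And>j. 0 \<le> w j" "summable w" and b: "\<And>j. w j \<le> b"
    and h: "summable (\<lambda>j. w j * (h j)\<^sup>2)" and "0 < \<eta>"
  defines "\<mu> \<equiv> \<Sum>j. w j * (h j)\<^sup>2"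
  shows "quad_cdf w h x \<le> quad_cdf w (\<lambda>_. 0) (x - \<mu> + \<eta>) + 4 * b * \<mu> / \<eta>\<^sup>2"
    and "quad_cdf w (\<lambda>_. 0) (x - \<mu> - \<eta>) \<le> quad_cdf w h x + 4 * b * \<mu> / \<eta>\<^sup>2"
proof -
  define L where "L \<omega> = quad w h \<omega> - quad w (\<lambda>_. 0) \<omega> - \<mu>" for \<omega>
  have L_meas [measurable]: "L \<in> borel_measurable M" unfolding L_def by measurable
  define c where "c j = 2 * w j * h j" for j
  have "AE \<omega> in M. (\<lambda>j. c j * \<xi> j \<omega>) sums L \<omega>"
    using AE_summable_noise[OF w]
  proof eventually_elim
    case (elim \<omega>)
    have sq: "summable (\<lambda>j. w j * (h j + \<xi> j \<omega>)\<^sup>2)"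
    proof (rule summable_comparison_test')
      show "summable (\<lambda>j. 2 * (w j * (h j)\<^sup>2) + 2 * (w j * (\<xi> j \<omega>)\<^sup>2))"
        using elim h by (intro summable_add summable_mult)
      have "(h j + \<xi> j \<omega>)\<^sup>2 \<le> 2 * (h j)\<^sup>2 + 2 * (\<xi> j \<omega>)\<^sup>2" for j
        using zero_le_power2[of "h j - \<xi> j \<omega>"] by (simp add: power2_eq_square algebra_simps)
      then show "norm (w j * (h j + \<xi> j \<omega>)\<^sup>2) \<le> 2 * (w j * (h j)\<^sup>2) + 2 * (w j * (\<xi> j \<omega>)\<^sup>2)" for j
        using mult_left_mono[OF _ w(1)[of j], of "(h j + \<xi> j \<omega>)\<^sup>2" "2 * (h j)\<^sup>2 + 2 * (\<xi> j \<omega>)\<^sup>2"] w(1)[of j]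
        by (simp add: algebra_simps)
    qed
    have eq: "c j * \<xi> j \<omega> = w j * (h j + \<xi> j \<omega>)\<^sup>2 - w j * (\<xi> j \<omega>)\<^sup>2 - w j * (h j)\<^sup>2" for j
      by (simp add: c_def power2_eq_square algebra_simps)
    have "(\<lambda>j. c j * \<xi> j \<omega>) sums
        ((\<Sum>j. w j * (h j + \<xi> j \<omega>)\<^sup>2) - (\<Sum>j. w j * (\<xi> j \<omega>)\<^sup>2) - \<mu>)"
      unfolding \<mu>_def eq using elim sq h by (intro sums_diff summable_sums)
    moreover have S1: "enn2real (\<Sum>j. ennreal (w j * (h j + \<xi> j \<omega>)\<^sup>2)) = (\<Sum>j. w j * (h j + \<xi> j \<omega>)\<^sup>2)"
      by (rule enn2real_suminf_ennreal[OF _ sq]) (simp add: w(1))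
    moreover have S2: "enn2real (\<Sum>j. ennreal (w j * (\<xi> j \<omega>)\<^sup>2)) = (\<Sum>j. w j * (\<xi> j \<omega>)\<^sup>2)"
      by (rule enn2real_suminf_ennreal[OF _ elim]) (simp add: w(1))
    have "L \<omega> = (\<Sum>j. w j * (h j + \<xi> j \<omega>)\<^sup>2) - (\<Sum>j. w j * (\<xi> j \<omega>)\<^sup>2) - \<mu>"
      unfolding L_def quad_def add_0 S1 S2 by (simp only: diff_diff_eq2 diff_add_cancel)
    ultimately show ?case by (simp only:)
  qed
  moreover have c_le: "(c j)\<^sup>2 \<le> 4 * b * (w j * (h j)\<^sup>2)" for j
  proof -
    have "w j * (4 * (w j * (h j)\<^sup>2)) \<le> b * (4 * (w j * (h j)\<^sup>2))"
      using w(1)[of j] by (intro mult_right_mono b) auto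
    then show ?thesis by (simp add: c_def power2_eq_square algebra_simps)
  qed
  moreover have c_sum: "summable (\<lambda>j. (c j)\<^sup>2)"
    by (rule summable_comparison_test'[OF summable_mult[OF h, of "4 * b"]]) (use c_le in auto)
  ultimately have "prob {\<omega> \<in> space M. \<eta> \<le> \<bar>L \<omega>\<bar>} \<le> (\<Sum>j. (c j)\<^sup>2) / \<eta>\<^sup>2"
    using \<open>0 < \<eta>\<close> by (intro linear_form_tail) auto
  also have "(\<Sum>j. (c j)\<^sup>2) \<le> (\<Sum>j. 4 * b * (w j * (h j)\<^sup>2))"
    by (intro suminf_le c_le c_sum summable_mult h)
  also have "\<dots> = 4 * b * \<mu>" unfolding \<mu>_def by (rule suminf_mult[OF h])
  finally have tail: "prob {\<omega> \<in> space M. \<eta> \<le> \<bar>L \<omega>\<bar>} \<le> 4 * b * \<mu> / \<eta>\<^sup>2"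
    using \<open>0 < \<eta>\<close> by (simp add: divide_right_mono)
  \<comment> \<open>Where |L| < \<eta>, the null statistic
    \<open>quad w h \<omega> - \<mu> - L \<omega>\<close> stays below x - \<mu> + \<eta>.\<close>
  have "quad_cdf w h x \<le> prob ({\<omega> \<in> space M. quad w (\<lambda>_. 0) \<omega> \<le> x - \<mu> + \<eta>} \<union> {\<omega> \<in> space M. \<eta> \<le> \<bar>L \<omega>\<bar>})"
    unfolding quad_cdf_def L_def by (intro finite_measure_mono) auto
  also have "\<dots> \<le> quad_cdf w (\<lambda>_. 0) (x - \<mu> + \<eta>) + prob {\<omega> \<in> space M. \<eta> \<le> \<bar>L \<omega>\<bar>}"
    unfolding quad_cdf_def by (intro measure_Un_le) auto
  finally show "quad_cdf w h x \<le> quad_cdf w (\<lambda>_. 0) (x - \<mu> + \<eta>) + 4 * b * \<mu> / \<eta>\<^sup>2"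
    using tail by simp
  have "quad_cdf w (\<lambda>_. 0) (x - \<mu> - \<eta>) \<le> prob ({\<omega> \<in> space M. quad w h \<omega> \<le> x} \<union> {\<omega> \<in> space M. \<eta> \<le> \<bar>L \<omega>\<bar>})"
    unfolding quad_cdf_def L_def by (intro finite_measure_mono) auto
  also have "\<dots> \<le> quad_cdf w h x + prob {\<omega> \<in> space M. \<eta> \<le> \<bar>L \<omega>\<bar>}"
    unfolding quad_cdf_def by (intro measure_Un_le) auto
  finally show "quad_cdf w (\<lambda>_. 0) (x - \<mu> - \<eta>) \<le> quad_cdf w h x + 4 * b * \<mu> / \<eta>\<^sup>2"
    using tail by simp
qed

section \<open>Which signals change the distribution function in the limit\<close>

lemma quad_cdf_mono: "x \<le> y \<Longrightarrow> quad_cdf w h x \<le> quad_cdf w h y"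
  unfolding quad_cdf_def by (intro finite_measure_mono) auto

lemma quad_cdf_bounds: "0 \<le> quad_cdf w h x" "quad_cdf w h x \<le> 1"
  unfolding quad_cdf_def by auto

text \<open>Let z be the p-quantile of the normal law. Convergence of the null probabilities to p
  forces the thresholds below z + a/4 eventually. With tolerance a/2 in
  \<open>quad_cdf_shift\<close> the effective threshold is at most z + a/4 - a + a/2 = z - a/4,
  where the null probability tends to a limit below p. The bound B on the shift makes the error from
  the linear term vanish with b.\<close>

lemma quad_detectable:
  fixes h :: "nat \<Rightarrow> nat \<Rightarrow> real"
  assumes w: "\<And>i j. 0 \<le> w i j" "\<And>i. summable (w i)" and b: "\<And>i j. w i j \<le> b i"
    and norm: "\<And>i. (\<lambda>j. (w i j)\<^sup>2) sums (1/2)" and b0: "b \<longlonglongrightarrow> 0"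
    and h: "\<And>i. summable (\<lambda>j. w i j * (h i j)\<^sup>2)"
    and a: "0 < a" "\<And>i. a \<le> (\<Sum>j. w i j * (h i j)\<^sup>2)" and B: "\<And>i. (\<Sum>j. w i j * (h i j)\<^sup>2) \<le> B"
    and p: "0 < p" "p < 1" "(\<lambda>i. quad_cdf (w i) (\<lambda>_. 0) (x i)) \<longlonglongrightarrow> p"
  obtains q where "q < p" "\<forall>\<^sub>F i in sequentially. quad_cdf (w i) (h i) (x i) \<le> q"
proof -
  let ?\<Phi> = "cdf std_normal_distribution"
  obtain z where z: "?\<Phi> z = p" using cdf_std_normal_quantile p by blast
  have lim: "(\<lambda>i. quad_cdf (w i) (\<lambda>_. 0) y) \<longlonglongrightarrow> ?\<Phi> y" for y
    by (rule quad_clt[OF w b norm b0])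
  have bpos: "0 \<le> b i" for i using w(1)[of i 0] b[of i 0] by simp
  obtain m where m: "p < m" "m < ?\<Phi> (z + a/4)"
    using dense[of p "?\<Phi> (z + a/4)"] cdf_std_normal_strict_mono[of z "z + a/4"] z a(1) by auto
  have 1: "\<forall>\<^sub>F i in sequentially. x i < z + a/4"
    using order_tendstoD(2)[OF p(3) m(1)] order_tendstoD(1)[OF lim m(2)]
  proof eventually_elim
    case (elim i)
    then show ?case using quad_cdf_mono[of "z + a/4" "x i" "w i" "\<lambda>_. 0"] by (smt (verit))
  qed
  obtain q where q: "?\<Phi> (z - a/4) < q" "q < p"
    using dense[of "?\<Phi> (z - a/4)" p] cdf_std_normal_strict_mono[of "z - a/4" z] z a(1) by auto
  have "(\<lambda>i. quad_cdf (w i) (\<lambda>_. 0) (z - a/4) + 4 * b i * B / (a/2)\<^sup>2) \<longlonglongrightarrow> ?\<Phi> (z - a/4) + 4 * 0 * B / (a/2)\<^sup>2"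
    using a(1) by (intro tendsto_intros lim b0) simp
  then have 2: "\<forall>\<^sub>F i in sequentially. quad_cdf (w i) (\<lambda>_. 0) (z - a/4) + 4 * b i * B / (a/2)\<^sup>2 < q"
    using q(1) by (intro order_tendstoD) auto
  have "\<forall>\<^sub>F i in sequentially. quad_cdf (w i) (h i) (x i) \<le> q"
    using 1 2
  proof eventually_elim
    case (elim i)
    let ?\<mu> = "\<Sum>j. w i j * (h i j)\<^sup>2"
    have "quad_cdf (w i) (h i) (x i) \<le> quad_cdf (w i) (\<lambda>_. 0) (x i - ?\<mu> + a/2) + 4 * b i * ?\<mu> / (a/2)\<^sup>2"
      using a(1) by (intro quad_cdf_shift w b h) auto
    also have "\<dots> \<le> quad_cdf (w i) (\<lambda>_. 0) (z - a/4) + 4 * b i * B / (a/2)\<^sup>2"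
      using elim(1) a(2)[of i] B[of i] bpos[of i]
      by (intro add_mono quad_cdf_mono divide_right_mono mult_left_mono) auto
    finally show ?case using elim(2) by simp
  qed
  with q(2) show ?thesis using that by blast
qed

text \<open>The bound has to be uniform in x, as thresholds may vary freely with the sample size.
  Polya's theorem replaces the null cdf by the normal one at x and at the shifted point, the
  Lipschitz bound controls the shift, and \<open>quad_cdf_shift\<close> connects to the cdf with
  signal. With \<eta> = \<epsilon>/5 the total error is below 4 \<eta>.\<close>

lemma quad_undetectable:
  fixes h :: "nat \<Rightarrow> nat \<Rightarrow> real"
  assumes w: "\<And>i j. 0 \<le> w i j" "\<And>i. summable (w i)" and b: "\<And>i j. w i j \<le> b i"
    and norm: "\<And>i. (\<lambda>j. (w i j)\<^sup>2) sums (1/2)" and b0: "b \<longlonglongrightarrow> 0"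
    and h: "\<And>i. summable (\<lambda>j. w i j * (h i j)\<^sup>2)"
    and \<mu>: "(\<lambda>i. \<Sum>j. w i j * (h i j)\<^sup>2) \<longlonglongrightarrow> 0" and "0 < \<epsilon>"
  shows "\<forall>\<^sub>F i in sequentially. \<forall>x. quad_cdf (w i) (\<lambda>_. 0) x - quad_cdf (w i) (h i) x \<le> \<epsilon>"
proof -
  let ?\<Phi> = "cdf std_normal_distribution" and ?\<eta> = "\<epsilon> / 5"
  let ?\<mu> = "\<lambda>i. \<Sum>j. w i j * (h i j)\<^sup>2"
  have unif: "\<forall>\<^sub>F i in sequentially. \<forall>x. \<bar>quad_cdf (w i) (\<lambda>_. 0) x - ?\<Phi> x\<bar> \<le> ?\<eta>"
    using \<open>0 < \<epsilon>\<close> quad_cdf_mono quad_cdf_bounds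
    by (intro cdf_std_normal_uniform_conv quad_clt[OF w b norm b0]) auto
  have "(\<lambda>i. ?\<mu> i + 4 * b i * ?\<mu> i / ?\<eta>\<^sup>2) \<longlonglongrightarrow> 0 + 4 * 0 * 0 / ?\<eta>\<^sup>2"
    using \<open>0 < \<epsilon>\<close> by (intro tendsto_intros b0 \<mu>) simp
  then have small: "\<forall>\<^sub>F i in sequentially. ?\<mu> i + 4 * b i * ?\<mu> i / ?\<eta>\<^sup>2 < ?\<eta>"
    by (rule order_tendstoD(2)) (use \<open>0 < \<epsilon>\<close> in simp)
  show ?thesis
    using unif small
  proof eventually_elim
    case (elim i)
    show ?case
    proof
      fix x
      let ?y = "x - ?\<mu> i - ?\<eta>"
      have "0 \<le> ?\<mu> i" using w(1) h by (intro suminf_nonneg) auto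
      then have "?\<Phi> x - ?\<Phi> ?y \<le> ?\<mu> i + ?\<eta>"
        using cdf_std_normal_lipschitz[of ?y x] \<open>0 < \<epsilon>\<close> by simp
      moreover have "\<bar>quad_cdf (w i) (\<lambda>_. 0) x - ?\<Phi> x\<bar> \<le> ?\<eta>" "\<bar>quad_cdf (w i) (\<lambda>_. 0) ?y - ?\<Phi> ?y\<bar> \<le> ?\<eta>"
        using elim(1) by blast+
      moreover have "quad_cdf (w i) (\<lambda>_. 0) ?y \<le> quad_cdf (w i) (h i) x + 4 * b i * ?\<mu> i / ?\<eta>\<^sup>2"
        using \<open>0 < \<epsilon>\<close> by (intro quad_cdf_shift w b h) auto
      ultimately show "quad_cdf (w i) (\<lambda>_. 0) x - quad_cdf (w i) (h i) x \<le> \<epsilon>"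
        using elim(2) by linarith
    qed
  qed
qed

end

section \<open>Square summable sequences\<close>

lemma atLeast1_eq_range_Suc: "{1..} = range Suc"
  by (metis One_nat_def atLeast_Suc_greaterThan greaterThan_0)

lemma summable_on_atLeast1_iff:
  fixes f :: "nat \<Rightarrow> real"
  assumes "\<And>j. 1 \<le> j \<Longrightarrow> 0 \<le> f j"
  shows "f summable_on {1..} \<longleftrightarrow> summable (\<lambda>j. f (Suc j))"
proof -
  have "f summable_on {1..} \<longleftrightarrow> (f \<circ> Suc) summable_on UNIV"
    unfolding atLeast1_eq_range_Suc by (rule summable_on_reindex) simp
  also have "\<dots> \<longleftrightarrow> summable (f \<circ> Suc)"
    using assms by (intro summable_on_UNIV_nonneg_real_iff) simp
  finally show ?thesis by (simp add: comp_def)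
qed

lemma infsum_atLeast1_eq_suminf:
  fixes f :: "nat \<Rightarrow> real"
  assumes "\<And>j. 1 \<le> j \<Longrightarrow> 0 \<le> f j" "summable (\<lambda>j. f (Suc j))"
  shows "infsum f {1..} = (\<Sum>j. f (Suc j))"
proof -
  have "infsum f {1..} = infsum (f \<circ> Suc) UNIV"
    unfolding atLeast1_eq_range_Suc by (rule infsum_reindex) simp
  moreover have "((f \<circ> Suc) has_sum (\<Sum>j. f (Suc j))) UNIV"
    using assms by (intro norm_summable_imp_has_sum) (auto simp: comp_def summable_sums)
  ultimately show ?thesis by (simp add: infsumI)
qed

text \<open>Both sides default to 0 when the series diverges. Hence the identity can be applied at
  every sample point, and not merely almost surely.\<close>

lemma infsum_atLeast1_eq_enn2real:
  fixes f :: "nat \<Rightarrow> real"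
  assumes "\<And>j. 1 \<le> j \<Longrightarrow> 0 \<le> f j"
  shows "infsum f {1..} = enn2real (\<Sum>j. ennreal (f (Suc j)))"
proof (cases "summable (\<lambda>j. f (Suc j))")
  case True
  then have "enn2real (\<Sum>j. ennreal (f (Suc j))) = (\<Sum>j. f (Suc j))"
    using assms by (simp add: suminf_ennreal2 suminf_nonneg)
  then show ?thesis using infsum_atLeast1_eq_suminf[OF assms True] by simp
next
  case False
  then have "infsum f {1..} = 0"
    using summable_on_atLeast1_iff[of f] assms by (simp add: infsum_not_exists)
  moreover have "(\<Sum>j. ennreal (f (Suc j))) = top"
  proof (rule ccontr)
    assume "(\<Sum>j. ennreal (f (Suc j))) \<noteq> top"
    then have "summable (\<lambda>j. f (Suc j))" by (rule summable_suminf_not_top[rotated]) (rule assms, simp)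
    then show False using False by contradiction
  qed
  ultimately show ?thesis by simp
qed

lemma l2norm_nonneg: "0 \<le> l2norm g"
  by (simp add: l2norm_def infsum_nonneg)

lemma l2norm_square: "(l2norm g)\<^sup>2 = (\<Sum>\<^sub>\<infinity>j\<in>{1..}. (g j)\<^sup>2)"
  by (simp add: l2norm_def infsum_nonneg)

lemma l2_product_summable:
  assumes "ell2 g" "ell2 h"
  shows "(\<lambda>j. g j * h j) summable_on {1..}"
proof -
  have s: "(\<lambda>j. (g j)\<^sup>2 + (h j)\<^sup>2) summable_on {1..}"
    using assms by (intro summable_on_add) (auto simp: ell2_def)
  have le: "\<bar>g j * h j\<bar> \<le> (g j)\<^sup>2 + (h j)\<^sup>2" for j
  proof -
    have "2 * (\<bar>g j\<bar> * \<bar>h j\<bar>) \<le> (g j)\<^sup>2 + (h j)\<^sup>2"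
      using zero_le_power2[of "\<bar>g j\<bar> - \<bar>h j\<bar>"] by (simp add: power2_diff)
    moreover have "0 \<le> \<bar>g j\<bar> * \<bar>h j\<bar>" by simp
    ultimately show ?thesis unfolding abs_mult by linarith
  qed
  have "(\<lambda>j. \<bar>g j * h j\<bar>) summable_on {1..}"
    by (rule summable_on_comparison_test[OF s]) (use le in auto)
  then show ?thesis using abs_summable_summable[of "\<lambda>j. g j * h j"] by simp
qed

lemma l2inner_Cauchy_Schwarz:
  assumes g: "ell2 g" and h: "ell2 h"
  shows "l2inner g h \<le> l2norm g * l2norm h"
  unfolding l2inner_def
proof (rule infsum_le_finite_sums[OF l2_product_summable[OF assms]])
  fix F :: "nat set"
  assume F: "finite F" "F \<subseteq> {1..}"
  have "(\<Sum>j\<in>F. g j * h j)\<^sup>2 \<le> (\<Sum>j\<in>F. (g j)\<^sup>2) * (\<Sum>j\<in>F. (h j)\<^sup>2)"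
    by (rule Cauchy_Schwarz_ineq_sum)
  also have "\<dots> \<le> (l2norm g)\<^sup>2 * (l2norm h)\<^sup>2"
    unfolding l2norm_square using F g h
    by (intro mult_mono finite_sum_le_infsum infsum_nonneg sum_nonneg) (auto simp: ell2_def)
  finally have "(\<Sum>j\<in>F. g j * h j)\<^sup>2 \<le> (l2norm g * l2norm h)\<^sup>2"
    by (simp add: power_mult_distrib)
  then show "(\<Sum>j\<in>F. g j * h j) \<le> l2norm g * l2norm h"
    by (rule power2_le_imp_le) (simp add: l2norm_nonneg)
qed

lemma ell2_diff:
  assumes "ell2 g" "ell2 h"
  shows "ell2 (\<lambda>j. g j - h j)"
  unfolding ell2_def
proof (rule summable_on_comparison_test)
  show "(\<lambda>j. 2 * (g j)\<^sup>2 + 2 * (h j)\<^sup>2) summable_on {1..}"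
    using assms by (intro summable_on_add summable_on_cmult_right) (auto simp: ell2_def)
  show "(g j - h j)\<^sup>2 \<le> 2 * (g j)\<^sup>2 + 2 * (h j)\<^sup>2" for j
    using zero_le_power2[of "g j + h j"] by (simp add: power2_eq_square algebra_simps)
qed simp

lemma ell2_mono:
  assumes "ell2 g" "\<And>j. \<bar>h j\<bar> \<le> \<bar>g j\<bar>"
  shows "ell2 h"
  unfolding ell2_def
proof (rule summable_on_comparison_test)
  show "(\<lambda>j. (g j)\<^sup>2) summable_on {1..}" using assms(1) by (simp add: ell2_def)
  show "(h j)\<^sup>2 \<le> (g j)\<^sup>2" for j using assms(2)[of j] by (simp add: abs_le_square_iff)
qed simp

section \<open>Truncation of a coefficient sequence\<close>

definition head :: "nat \<Rightarrow> (nat \<Rightarrow> real) \<Rightarrow> nat \<Rightarrow> real" where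
  "head m g j = (if j \<le> m then g j else 0)"

definition tail :: "nat \<Rightarrow> (nat \<Rightarrow> real) \<Rightarrow> nat \<Rightarrow> real" where
  "tail m g j = (if j \<le> m then 0 else g j)"

lemma ell2_head_tail:
  assumes "ell2 g"
  shows "ell2 (head m g)" "ell2 (tail m g)"
  by (rule ell2_mono[OF assms]; simp add: head_def tail_def)+

lemma l2norm_head_tail:
  assumes "ell2 g"
  shows "(l2norm g)\<^sup>2 = (l2norm (head m g))\<^sup>2 + (l2norm (tail m g))\<^sup>2"
proof -
  have eq: "(g j)\<^sup>2 = (head m g j)\<^sup>2 + (tail m g j)\<^sup>2" for j by (simp add: head_def tail_def)
  show ?thesis unfolding l2norm_square eq
    using ell2_head_tail[OF assms, of m] by (intro infsum_add) (auto simp: ell2_def)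
qed

lemma l2norm_head: "(l2norm (head m g))\<^sup>2 = (\<Sum>j\<in>{1..m}. (g j)\<^sup>2)"
proof -
  have "(l2norm (head m g))\<^sup>2 = (\<Sum>\<^sub>\<infinity>j\<in>{1..m}. (g j)\<^sup>2)"
    unfolding l2norm_square by (rule infsum_cong_neutral) (auto simp: head_def)
  then show ?thesis by simp
qed

lemma l2norm_tail: "(l2norm (tail m g))\<^sup>2 = (\<Sum>\<^sub>\<infinity>j\<in>{j. 1 \<le> j \<and> real j > real m}. (g j)\<^sup>2)"
  unfolding l2norm_square by (rule infsum_cong_neutral) (auto simp: tail_def)

lemma l2norm_tail_tendsto:
  assumes "ell2 g"
  shows "(\<lambda>m. l2norm (tail m g)) \<longlonglongrightarrow> 0"
proof -
  have sm: "summable (\<lambda>j. (g (Suc j))\<^sup>2)"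
    using assms summable_on_atLeast1_iff[of "\<lambda>j. (g j)\<^sup>2"] by (simp add: ell2_def)
  have "(\<lambda>j. (g (Suc j))\<^sup>2) sums (l2norm g)\<^sup>2"
    unfolding l2norm_square using sm infsum_atLeast1_eq_suminf[of "\<lambda>j. (g j)\<^sup>2"] by (simp add: sums_iff)
  moreover have "(\<Sum>j<m. (g (Suc j))\<^sup>2) = (l2norm (head m g))\<^sup>2" for m
    unfolding l2norm_head by (rule sum.reindex_bij_witness[of _ "\<lambda>j. j - 1" Suc]) auto
  ultimately have "(\<lambda>m. (l2norm (head m g))\<^sup>2) \<longlonglongrightarrow> (l2norm g)\<^sup>2" by (simp add: sums_def)
  then have "(\<lambda>m. (l2norm g)\<^sup>2 - (l2norm (head m g))\<^sup>2) \<longlonglongrightarrow> (l2norm g)\<^sup>2 - (l2norm g)\<^sup>2"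
    by (rule tendsto_diff[OF tendsto_const])
  moreover have "(l2norm g)\<^sup>2 - (l2norm (head m g))\<^sup>2 = (l2norm (tail m g))\<^sup>2" for m
    using l2norm_head_tail[OF assms, of m] by simp
  ultimately have "(\<lambda>m. (l2norm (tail m g))\<^sup>2) \<longlonglongrightarrow> 0" by simp
  then have "(\<lambda>m. sqrt ((l2norm (tail m g))\<^sup>2)) \<longlonglongrightarrow> sqrt 0" by (intro tendsto_intros)
  then show ?thesis by (simp add: l2norm_nonneg)
qed

lemma l2inner_self: "l2inner g g = (l2norm g)\<^sup>2"
  unfolding l2inner_def l2norm_square by (simp add: power2_eq_square)

lemma l2inner_diff_right:
  assumes "ell2 g" "ell2 h" "ell2 k"
  shows "l2inner g (\<lambda>j. h j - k j) = l2inner g h - l2inner g k"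
proof -
  have "l2inner g (\<lambda>j. h j - k j) = (\<Sum>\<^sub>\<infinity>j\<in>{1..}. g j * h j + (-1) * (g j * k j))"
    unfolding l2inner_def by (simp add: algebra_simps)
  also have "\<dots> = l2inner g h + (\<Sum>\<^sub>\<infinity>j\<in>{1..}. (-1) * (g j * k j))"
    unfolding l2inner_def using l2_product_summable assms
    by (intro infsum_add summable_on_cmult_right) auto
  also have "(\<Sum>\<^sub>\<infinity>j\<in>{1..}. (-1) * (g j * k j)) = (-1) * l2inner g k"
    unfolding l2inner_def by (rule infsum_cmult_right) (use l2_product_summable assms in auto)
  finally show ?thesis by simp
qed

lemma l2inner_head_tail:
  assumes "ell2 g" "ell2 h"
  shows "l2inner g h = l2inner (head m g) h + l2inner g (tail m h)"
proof -
  have eq: "g j * h j = head m g j * h j + g j * tail m h j" for j by (simp add: head_def tail_def)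
  have "l2inner g h = (\<Sum>\<^sub>\<infinity>j\<in>{1..}. head m g j * h j + g j * tail m h j)"
    unfolding l2inner_def by (simp only: eq)
  also have "\<dots> = l2inner (head m g) h + l2inner g (tail m h)"
    unfolding l2inner_def
    by (rule infsum_add) (intro l2_product_summable ell2_head_tail assms)+
  finally show ?thesis .
qed

text \<open>Orthogonality makes the squared norm of g equal to its inner product with f, and
  Cauchy-Schwarz concludes. An orthogonal part thus inherits the upper bound of order
  n^(-r).\<close>

lemma l2norm_le_if_orthogonal:
  assumes "ell2 g" "ell2 f" "l2inner g (\<lambda>j. f j - g j) = 0"
  shows "l2norm g \<le> l2norm f"
proof (cases "l2norm g = 0")
  case False
  then have pos: "0 < l2norm g" using l2norm_nonneg[of g] by simp
  have "l2norm g * l2norm g = l2inner g f"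
    using l2inner_diff_right[OF assms(1,2,1)] assms(3) by (simp add: l2inner_self power2_eq_square)
  also have "\<dots> \<le> l2norm g * l2norm f" by (rule l2inner_Cauchy_Schwarz[OF assms(1,2)])
  finally show ?thesis using pos by simp
qed (simp add: l2norm_nonneg)

section \<open>Orders of magnitude of the weights\<close>

text \<open>Here x is the weight sequence for one sample size. Since k is the largest index whose
  predecessors carry at most half the mass, the first k weights carry more than half; each of them
  lies between \<open>x k\<close> and \<open>C * x k\<close>. The remaining bounds compare each
  square with \<open>(x k)^2\<close> from below on the first k indices, and with
  \<open>C * x k * x j\<close> from above on all indices.\<close>

lemma median_index_bounds:
  fixes x :: "nat \<Rightarrow> real" and k :: nat
  assumes nonneg: "\<And>j. 0 \<le> x j" and summ: "x summable_on {1..}"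
    and anti: "\<And>i j. 1 \<le> i \<Longrightarrow> i \<le> j \<Longrightarrow> x j \<le> x i"
    and pos: "0 < infsum x {1..}"
    and k_def: "k = Sup {k::nat. (\<Sum>j\<in>{1..<k}. x j) \<le> infsum x {1..} / 2}"
    and C: "x 1 \<le> C * x k"
  shows "1 \<le> k" "(\<lambda>j. (x j)\<^sup>2) summable_on {1..}"
    "infsum x {1..} / 2 \<le> C * (real k * x k)"
    "real k * (x k)\<^sup>2 \<le> (\<Sum>\<^sub>\<infinity>j\<in>{1..}. (x j)\<^sup>2)"
    "(\<Sum>\<^sub>\<infinity>j\<in>{1..}. (x j)\<^sup>2) \<le> C * x k * infsum x {1..}"
proof -
  let ?\<rho> = "infsum x {1..}"
  let ?K = "{k::nat. (\<Sum>j\<in>{1..<k}. x j) \<le> ?\<rho> / 2}"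
  have sm: "summable (\<lambda>j. x (Suc j))" using summable_on_atLeast1_iff[of x] nonneg summ by simp
  have "(\<lambda>j. x (Suc j)) sums ?\<rho>"
    using sm infsum_atLeast1_eq_suminf[of x] nonneg by (simp add: sums_iff)
  then have "(\<lambda>m. \<Sum>j<m. x (Suc j)) \<longlonglongrightarrow> ?\<rho>" by (simp add: sums_def)
  then have "\<forall>\<^sub>F m in sequentially. ?\<rho> / 2 < (\<Sum>j<m. x (Suc j))"
    using pos by (intro order_tendstoD) auto
  then obtain m where m: "?\<rho> / 2 < (\<Sum>j<m. x (Suc j))" by (meson eventually_sequentially order_refl)
  have reidx: "(\<Sum>j<m. x (Suc j)) = (\<Sum>j\<in>{1..<Suc m}. x j)" for m
    using sum.shift_bounds_Suc_ivl[of x 0 m] by (simp add: atLeast0LessThan)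
  \<comment> \<open>The supremum of a set of naturals is defined through \<open>Max\<close>, which
    is informative only for finite nonempty sets; finiteness comes from the partial sums exceeding
    half of the total.\<close>
  have "k' \<le> m" if "k' \<in> ?K" for k'
  proof (rule ccontr)
    assume "\<not> k' \<le> m"
    then have "(\<Sum>j\<in>{1..<Suc m}. x j) \<le> (\<Sum>j\<in>{1..<k'}. x j)"
      using nonneg by (intro sum_mono2) auto
    then show False using m that reidx[of m] by simp
  qed
  then have fin: "finite ?K" by (meson finite_nat_set_iff_bounded_le)
  have one: "1 \<in> ?K" using pos by simp
  have kMax: "k = Max ?K" unfolding k_def Sup_nat_def using one by (metis (no_types, lifting) empty_iff)
  show "1 \<le> k" unfolding kMax using fin one by (intro Max_ge) auto
  have "Suc k \<notin> ?K"
  proof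
    assume "Suc k \<in> ?K"
    then have "Suc k \<le> Max ?K" by (rule Max_ge[OF fin])
    then show False using kMax by simp
  qed
  then have "?\<rho> / 2 < (\<Sum>j\<in>{1..<Suc k}. x j)" by simp
  also have "\<dots> \<le> (\<Sum>j\<in>{1..<Suc k}. x 1)" by (intro sum_mono anti) auto
  also have "\<dots> = real k * x 1" by simp
  also have "\<dots> \<le> real k * (C * x k)" by (intro mult_left_mono C) auto
  finally show "?\<rho> / 2 \<le> C * (real k * x k)" by (simp add: algebra_simps)
  have sq_le: "(x j)\<^sup>2 \<le> C * x k * x j" if "1 \<le> j" for j
    using mult_right_mono[OF order_trans[OF anti[of 1 j] C] nonneg[of j]] that
    by (simp add: power2_eq_square)
  show sq: "(\<lambda>j. (x j)\<^sup>2) summable_on {1..}"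
    by (rule summable_on_comparison_test[OF summable_on_cmult_right[OF summ, of "C * x k"]])
       (use sq_le in auto)
  have "(\<Sum>\<^sub>\<infinity>j\<in>{1..}. (x j)\<^sup>2) \<le> (\<Sum>\<^sub>\<infinity>j\<in>{1..}. C * x k * x j)"
    using sq_le by (intro infsum_mono sq summable_on_cmult_right summ) auto
  also have "\<dots> = C * x k * ?\<rho>" by (rule infsum_cmult_right) (use summ in auto)
  finally show "(\<Sum>\<^sub>\<infinity>j\<in>{1..}. (x j)\<^sup>2) \<le> C * x k * ?\<rho>" .
  have "real k * (x k)\<^sup>2 = (\<Sum>j\<in>{1..k}. (x k)\<^sup>2)" by simp
  also have "\<dots> \<le> (\<Sum>j\<in>{1..k}. (x j)\<^sup>2)" by (intro sum_mono power_mono anti nonneg) auto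
  also have "\<dots> \<le> (\<Sum>\<^sub>\<infinity>j\<in>{1..}. (x j)\<^sup>2)"
    by (rule finite_sum_le_infsum[OF sq]) auto
  finally show "real k * (x k)\<^sup>2 \<le> (\<Sum>\<^sub>\<infinity>j\<in>{1..}. (x j)\<^sup>2)" .
qed

text \<open>Solving for the two unknowns: \<rho> is of order k y, and Q of order y \<rho>, so y is
  of order Q / \<rho>, that is N^(2r-2), and k of order \<rho> / y, that is N^(2-4r). The upper
  bound on k comes from k y^2 \<le> Q and the lower bound on y.\<close>

lemma order_of_median_weight:
  fixes N r C c1 c2 q1 q2 \<rho> Q y k :: real
  assumes "0 < N" "0 < c1" "0 < c2" "0 < q1" "0 < q2" "0 < C"
    and \<rho>: "c1 * N powr (-2*r) \<le> \<rho>" "\<rho> \<le> c2 * N powr (-2*r)"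
    and Q: "q1 * N powr (-2) \<le> Q" "Q \<le> q2 * N powr (-2)"
    and "0 < k" "0 < y"
    and 1: "\<rho> / 2 \<le> C * (k * y)" and 2: "k * y\<^sup>2 \<le> Q" and 3: "Q \<le> C * y * \<rho>"
  shows "q1 / (C * c2) * N powr (2*r - 2) \<le> y"
    and "y \<le> 2 * C * q2 / c1 * N powr (2*r - 2)"
    and "c1\<^sup>2 / (4 * C\<^sup>2 * q2) * N powr (2 - 4*r) \<le> k"
    and "k \<le> q2 * (C * c2 / q1)\<^sup>2 * N powr (2 - 4*r)"
proof -
  define A where "A = N powr (-2*r)"
  define B where "B = N powr (-2)"
  have AB: "0 < A" "0 < B" unfolding A_def B_def using assms by auto
  have e1: "N powr (2*r - 2) = B / A"
    unfolding A_def B_def using assms by (simp add: powr_diff[symmetric] powr_minus_divide[symmetric])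
  have e2: "N powr (2 - 4*r) = A\<^sup>2 / B"
    unfolding A_def B_def using assms
    by (simp add: powr_diff[symmetric] power2_eq_square powr_add[symmetric])
  note \<rho>' = \<rho>[folded A_def] and Q' = Q[folded B_def]
  have "0 < \<rho>" using \<rho>'(1) AB assms by (smt (verit) mult_pos_pos)
  have "q1 * B \<le> C * y * (c2 * A)"
  proof -
    have "C * y * \<rho> \<le> C * y * (c2 * A)" using \<rho>'(2) assms by (intro mult_left_mono) auto
    then show ?thesis using Q'(1) 3 by linarith
  qed
  then show y1: "q1 / (C * c2) * N powr (2*r - 2) \<le> y"
    unfolding e1 using AB assms by (simp add: field_simps)
  have "c1 * A / 2 * y \<le> C * (k * y) * y"
    using 1 \<rho>'(1) assms by (intro mult_right_mono) auto
  also have "\<dots> \<le> C * Q" using 2 assms by (simp add: power2_eq_square)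
  also have "\<dots> \<le> C * (q2 * B)" using Q' assms by simp
  finally show y2: "y \<le> 2 * C * q2 / c1 * N powr (2*r - 2)"
    unfolding e1 using AB assms by (simp add: field_simps)
  have "c1 * A / 2 \<le> C * (k * y)" using 1 \<rho>'(1) by simp
  also have "\<dots> \<le> C * (k * (2 * C * q2 / c1 * (B / A)))"
    using y2 assms unfolding e1 by (intro mult_left_mono) auto
  finally show "c1\<^sup>2 / (4 * C\<^sup>2 * q2) * N powr (2 - 4*r) \<le> k"
    unfolding e2 using AB assms by (simp add: field_simps power2_eq_square)
  have "k * (q1 / (C * c2) * (B / A))\<^sup>2 \<le> k * y\<^sup>2"
    using y1 AB assms unfolding e1 by (intro mult_left_mono power_mono) auto
  also have "\<dots> \<le> q2 * B" using 2 Q' by simp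
  finally show "k \<le> q2 * (C * c2 / q1)\<^sup>2 * N powr (2 - 4*r)"
    unfolding e2 using AB assms by (simp add: field_simps power2_eq_square)
qed

locale quadratic_test = prob_space M for M :: "'a measure" +
  fixes \<xi> :: "nat \<Rightarrow> 'a \<Rightarrow> real" and \<sigma> r :: real and \<kappa> :: "nat \<Rightarrow> nat \<Rightarrow> real"
  assumes indep: "indep_vars (\<lambda>_. borel) \<xi> UNIV"
    and gauss: "\<forall>j. distributed M lborel (\<xi> j) std_normal_density"
    and sigma: "\<sigma> > 0"
    and r: "0 < r" "r < 1/2"
    and kpos: "\<forall>n j. 0 \<le> \<kappa> n j"
    and ksum: "\<forall>n\<ge>1. \<kappa> n summable_on {1..}"
    and A1: "\<forall>n\<ge>1. \<forall>j\<ge>1. \<kappa> n (Suc j) \<le> \<kappa> n j"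
    and A2: "\<exists>C1 C2. 0 < C1 \<and> (\<forall>n\<ge>1.
               C1 < \<sigma> powr (-4) * (real n)^2 * (\<Sum>\<^sub>\<infinity>j\<in>{1..}. (\<kappa> n j)^2)
             \<and> \<sigma> powr (-4) * (real n)^2 * (\<Sum>\<^sub>\<infinity>j\<in>{1..}. (\<kappa> n j)^2) < C2)"
    and A3: "\<exists>c1 c2. 0 < c1 \<and> (\<forall>n\<ge>1. c1 * real n powr (-2*r) \<le> rho \<kappa> n
                                  \<and> rho \<kappa> n \<le> c2 * real n powr (-2*r))"
    and A4: "\<exists>C1 lam. C1 > 0 \<and> lam > 1 \<and> (\<forall>\<delta>>0. \<forall>n\<ge>1.
               \<kappa> n (nat \<lfloor>(1 + \<delta>) * real (kn \<kappa> n)\<rfloor>) < C1 * (1 + \<delta>) powr (-lam) * kappa_n \<kappa> n)"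
    and A5a: "\<exists>c C. 0 < c \<and> (\<forall>n\<ge>1. c * kappa_n \<kappa> n \<le> \<kappa> n 1 \<and> \<kappa> n 1 \<le> C * kappa_n \<kappa> n)"
    and A5b: "\<forall>c>1. \<exists>C>0. \<forall>n\<ge>1. \<kappa> n (nat \<lfloor>c * real (kn \<kappa> n)\<rfloor>) \<ge> C * kappa_n \<kappa> n"
begin

sublocale noise: gaussian_noise M "\<lambda>j. \<xi> (Suc j)"
proof
  have "indep_vars (\<lambda>_. borel) \<xi> (range Suc)" by (rule indep_vars_subset[OF indep]) simp
  then show "indep_vars (\<lambda>_. borel) (\<lambda>j. \<xi> (Suc j)) UNIV"
    using indep_vars_reindex_inj[of Suc UNIV "\<lambda>_. borel" \<xi>] by simp
qed (use gauss in simp)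

lemma kappa_antimono:
  assumes "1 \<le> n" "1 \<le> i" "i \<le> j"
  shows "\<kappa> n j \<le> \<kappa> n i"
  using assms(3)
proof (induction rule: dec_induct)
  case (step m)
  then show ?case using A1 assms order_trans[of "\<kappa> n (Suc m)" "\<kappa> n m"] by simp
qed simp

definition power_sum :: "nat \<Rightarrow> real" where
  "power_sum n = (\<Sum>\<^sub>\<infinity>j\<in>{1..}. (\<kappa> n j)\<^sup>2)"

text \<open>Combines A1, A2, A3 and the comparability of the first weight with
  \<open>kappa_n\<close> from A5. A single pair of constants serves all the bounds, so that later
  proofs can pick whichever orders they use.\<close>

lemma weight_orders:
  obtains c C where "0 < c" "0 < C"
    "\<And>n. 1 \<le> n \<Longrightarrow> 1 \<le> kn \<kappa> n"
    "\<And>n. 1 \<le> n \<Longrightarrow> (\<lambda>j. (\<kappa> n j)\<^sup>2) summable_on {1..}"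
    "\<And>n. 1 \<le> n \<Longrightarrow> c * real n powr (2*r - 2) \<le> kappa_n \<kappa> n"
    "\<And>n. 1 \<le> n \<Longrightarrow> kappa_n \<kappa> n \<le> C * real n powr (2*r - 2)"
    "\<And>n. 1 \<le> n \<Longrightarrow> \<kappa> n 1 \<le> C * real n powr (2*r - 2)"
    "\<And>n. 1 \<le> n \<Longrightarrow> c * real n powr (2 - 4*r) \<le> real (kn \<kappa> n)"
    "\<And>n. 1 \<le> n \<Longrightarrow> real (kn \<kappa> n) \<le> C * real n powr (2 - 4*r)"
    "\<And>n. 1 \<le> n \<Longrightarrow> c * real n powr (-2) \<le> power_sum n"
    "\<And>n. 1 \<le> n \<Longrightarrow> power_sum n \<le> C * real n powr (-2)"
proof -
  obtain Q1 Q2 where Q: "0 < Q1" "\<And>n. 1 \<le> n \<Longrightarrow> Q1 < \<sigma> powr (-4) * (real n)\<^sup>2 * power_sum n"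
    "\<And>n. 1 \<le> n \<Longrightarrow> \<sigma> powr (-4) * (real n)\<^sup>2 * power_sum n < Q2"
    using A2 unfolding power_sum_def by metis
  obtain c1 c2 where \<rho>: "0 < c1" "\<And>n. 1 \<le> n \<Longrightarrow> c1 * real n powr (-2*r) \<le> rho \<kappa> n"
    "\<And>n. 1 \<le> n \<Longrightarrow> rho \<kappa> n \<le> c2 * real n powr (-2*r)"
    using A3 by metis
  obtain K where K: "\<And>n. 1 \<le> n \<Longrightarrow> \<kappa> n 1 \<le> K * kappa_n \<kappa> n" using A5a by metis
  have "0 < c2" using \<rho>(1) \<rho>(2)[of 1] \<rho>(3)[of 1] by simp
  have "0 < Q2" using Q(1) Q(2)[of 1] Q(3)[of 1] by simp
  have \<rho>pos: "0 < rho \<kappa> n" if "1 \<le> n" for n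
  proof -
    have "0 < c1 * real n powr (-2*r)" using \<rho>(1) that by simp
    then show ?thesis using \<rho>(2)[OF that] by linarith
  qed
  \<comment> \<open>If the first weight were 0, monotonicity would make all weights vanish, against
    the positive lower bound for \<open>rho\<close>. This is what yields positivity of
    \<open>kappa_n\<close> and of the constant in A5.\<close>
  have \<kappa>1pos: "0 < \<kappa> n 1" if "1 \<le> n" for n
  proof (rule ccontr)
    assume "\<not> 0 < \<kappa> n 1"
    then have "\<kappa> n j = 0" if "j \<in> {1..}" for j
      using kappa_antimono[of n 1 j] kpos that \<open>1 \<le> n\<close> by (smt (verit) atLeast_iff order_refl)
    then have "rho \<kappa> n = 0" unfolding rho_def by (rule infsum_0)
    then show False using \<rho>pos[OF \<open>1 \<le> n\<close>] by simp
  qed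
  have kpos': "0 < K \<and> 0 < kappa_n \<kappa> n" if "1 \<le> n" for n
  proof -
    have "0 < K * kappa_n \<kappa> n" using K[OF that] \<kappa>1pos[OF that] by simp
    moreover have "0 \<le> kappa_n \<kappa> n" using kpos by (simp add: kappa_n_def)
    ultimately show ?thesis by (simp add: zero_less_mult_iff)
  qed
  have "0 < K" using kpos'[of 1] by simp
  have med: "1 \<le> kn \<kappa> n" "(\<lambda>j. (\<kappa> n j)\<^sup>2) summable_on {1..}"
    "rho \<kappa> n / 2 \<le> K * (real (kn \<kappa> n) * kappa_n \<kappa> n)"
    "real (kn \<kappa> n) * (kappa_n \<kappa> n)\<^sup>2 \<le> power_sum n"
    "power_sum n \<le> K * kappa_n \<kappa> n * rho \<kappa> n" if "1 \<le> n" for n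
    using median_index_bounds[of "\<kappa> n" "kn \<kappa> n" K] kpos ksum kappa_antimono[OF that] \<rho>pos[OF that] K[OF that] that
    unfolding kn_def rho_def kappa_n_def power_sum_def by auto
  define q1 where "q1 = Q1 * \<sigma> ^ 4"
  define q2 where "q2 = Q2 * \<sigma> ^ 4"
  have q: "0 < q1" "0 < q2" unfolding q1_def q2_def using \<open>0 < Q1\<close> \<open>0 < Q2\<close> sigma by auto
  have Q': "q1 * real n powr (-2) \<le> power_sum n" "power_sum n \<le> q2 * real n powr (-2)" if "1 \<le> n" for n
  proof -
    have s4: "\<sigma> powr (-4) = 1 / \<sigma> ^ 4" using sigma by (simp add: powr_minus_divide)
    have n2: "real n powr (-2) = 1 / (real n)\<^sup>2" using that by (simp add: powr_minus_divide)
    show "q1 * real n powr (-2) \<le> power_sum n" "power_sum n \<le> q2 * real n powr (-2)"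
      using Q(2,3)[OF that] sigma that unfolding s4 n2 q1_def q2_def by (simp_all add: field_simps)
  qed
  have ord: "q1 / (K * c2) * real n powr (2*r - 2) \<le> kappa_n \<kappa> n"
    "kappa_n \<kappa> n \<le> 2 * K * q2 / c1 * real n powr (2*r - 2)"
    "c1\<^sup>2 / (4 * K\<^sup>2 * q2) * real n powr (2 - 4*r) \<le> real (kn \<kappa> n)"
    "real (kn \<kappa> n) \<le> q2 * (K * c2 / q1)\<^sup>2 * real n powr (2 - 4*r)" if "1 \<le> n" for n
    using order_of_median_weight[of "real n" c1 c2 q1 q2 K r "rho \<kappa> n" "power_sum n" "real (kn \<kappa> n)" "kappa_n \<kappa> n"]
      \<rho>(1) \<rho>(2,3)[OF that] \<open>0 < c2\<close> q \<open>0 < K\<close> Q'[OF that] med[OF that] kpos'[OF that] that by simp_all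
  define c where "c = Min {q1 / (K * c2), c1\<^sup>2 / (4 * K\<^sup>2 * q2), q1}"
  define C where "C = Max {2 * K * q2 / c1, K * (2 * K * q2 / c1), q2 * (K * c2 / q1)\<^sup>2, q2}"
  have c_le: "c \<le> q1 / (K * c2)" "c \<le> c1\<^sup>2 / (4 * K\<^sup>2 * q2)" "c \<le> q1" unfolding c_def by auto
  have C_ge: "2 * K * q2 / c1 \<le> C" "K * (2 * K * q2 / c1) \<le> C" "q2 * (K * c2 / q1)\<^sup>2 \<le> C" "q2 \<le> C"
    unfolding C_def by (intro Max_ge; simp)+
  have "0 < c" unfolding c_def using q \<open>0 < K\<close> \<open>0 < c1\<close> \<open>0 < c2\<close> by simp
  have "0 < C" using C_ge(4) q by simp
  show thesis
  proof (rule that[of c C])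
    fix n :: nat
    assume n: "1 \<le> n"
    let ?p = "real n powr (2*r - 2)" and ?k = "real n powr (2 - 4*r)" and ?m = "real n powr (-2)"
    show "1 \<le> kn \<kappa> n" "(\<lambda>j. (\<kappa> n j)\<^sup>2) summable_on {1..}" using med[OF n] by auto
    show "c * ?p \<le> kappa_n \<kappa> n"
      by (rule order_trans[OF mult_right_mono[OF c_le(1)] ord(1)[OF n]]) simp
    show "kappa_n \<kappa> n \<le> C * ?p"
      by (rule order_trans[OF ord(2)[OF n] mult_right_mono[OF C_ge(1)]]) simp
    have "\<kappa> n 1 \<le> K * (2 * K * q2 / c1 * ?p)"
      using K[OF n] mult_left_mono[OF ord(2)[OF n], of K] \<open>0 < K\<close> by simp
    then have "\<kappa> n 1 \<le> K * (2 * K * q2 / c1) * ?p" by (simp add: mult.assoc)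
    then show "\<kappa> n 1 \<le> C * ?p"
      by (rule order_trans[OF _ mult_right_mono[OF C_ge(2)]]) simp
    show "c * ?k \<le> real (kn \<kappa> n)"
      by (rule order_trans[OF mult_right_mono[OF c_le(2)] ord(3)[OF n]]) simp
    show "real (kn \<kappa> n) \<le> C * ?k"
      by (rule order_trans[OF ord(4)[OF n] mult_right_mono[OF C_ge(3)]]) simp
    show "c * ?m \<le> power_sum n"
      by (rule order_trans[OF mult_right_mono[OF c_le(3)] Q'(1)[OF n]]) simp
    show "power_sum n \<le> C * ?m"
      by (rule order_trans[OF Q'(2)[OF n] mult_right_mono[OF C_ge(4)]]) simp
  qed fact+
qed

section \<open>Standardisation of the test statistic\<close>

definition noise_scale :: "nat \<Rightarrow> real" where
  "noise_scale n = \<sigma>\<^sup>2 / real n * sqrt (2 * power_sum n)"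

text \<open>\<open>noise_scale\<close> is the null standard deviation of \<open>Tstat\<close>, as a
  centred squared normal has variance 2. Dividing by it leaves these weights, normalised so that
  their squares add up to 1/2; the index is shifted so that series start at 0.\<close>

definition weight :: "nat \<Rightarrow> nat \<Rightarrow> real" where
  "weight n j = \<kappa> n (Suc j) / sqrt (2 * power_sum n)"

text \<open>The coefficients measured in units of the noise level \<sigma> n^(-1/2).\<close>

definition std_signal :: "nat \<Rightarrow> (nat \<Rightarrow> real) \<Rightarrow> nat \<Rightarrow> real" where
  "std_signal n g j = g (Suc j) * sqrt (real n) / \<sigma>"

text \<open>The displacement of the mean of \<open>Tstat\<close> caused by the signal g; its size
  relative to n^(-2) decides visibility.\<close>

definition energy :: "nat \<Rightarrow> (nat \<Rightarrow> real) \<Rightarrow> real" where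
  "energy n g = (\<Sum>\<^sub>\<infinity>j\<in>{1..}. \<kappa> n j * (g j)\<^sup>2)"

lemma power_sum_pos: "1 \<le> n \<Longrightarrow> 0 < power_sum n"
proof -
  assume n: "1 \<le> n"
  obtain c where c: "0 < c" "\<And>n. 1 \<le> n \<Longrightarrow> c * real n powr (-2) \<le> power_sum n"
    using weight_orders by metis
  have "0 < c * real n powr (-2)" using c(1) n by simp
  then show ?thesis using c(2)[OF n] by linarith
qed

lemma noise_scale_pos: "1 \<le> n \<Longrightarrow> 0 < noise_scale n"
  using power_sum_pos sigma by (simp add: noise_scale_def)

lemma weight_nonneg: "0 \<le> weight n j"
proof -
  have "0 \<le> power_sum n" unfolding power_sum_def by (simp add: infsum_nonneg)
  then show ?thesis using kpos by (simp add: weight_def)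
qed

lemma kappa_summable: "1 \<le> n \<Longrightarrow> summable (\<lambda>j. \<kappa> n (Suc j))"
  by (subst summable_on_atLeast1_iff[symmetric]) (use kpos ksum in blast)+

lemma weight_summable: "1 \<le> n \<Longrightarrow> summable (weight n)"
  unfolding weight_def[abs_def] by (intro summable_divide kappa_summable)

lemma weight_le: "1 \<le> n \<Longrightarrow> weight n j \<le> \<kappa> n 1 / sqrt (2 * power_sum n)"
  unfolding weight_def using kappa_antimono[of n 1 "Suc j"] power_sum_pos[of n]
  by (intro divide_right_mono) auto

lemma weight_normalised:
  assumes n: "1 \<le> n"
  shows "(\<lambda>j. (weight n j)\<^sup>2) sums (1/2)"
proof -
  have sm: "summable (\<lambda>j. (\<kappa> n (Suc j))\<^sup>2)"
    using weight_orders summable_on_atLeast1_iff[of "\<lambda>j. (\<kappa> n j)\<^sup>2"] n by (metis zero_le_power2)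
  then have "(\<lambda>j. (\<kappa> n (Suc j))\<^sup>2) sums power_sum n"
    using infsum_atLeast1_eq_suminf[of "\<lambda>j. (\<kappa> n j)\<^sup>2"] by (simp add: power_sum_def sums_iff)
  then have "(\<lambda>j. (\<kappa> n (Suc j))\<^sup>2 / (2 * power_sum n)) sums (power_sum n / (2 * power_sum n))"
    by (rule sums_divide)
  then show ?thesis using power_sum_pos[OF n] by (simp add: weight_def power_divide)
qed

text \<open>Factoring out the noise level gives the identity term by term. It holds at every sample
  point, since both infinite sums take the value 0 when they diverge.\<close>

lemma Tstat_eq_quad:
  assumes n: "1 \<le> n"
  shows "Tstat \<sigma> \<kappa> \<xi> n g \<omega> = noise_scale n * noise.quad (weight n) (std_signal n g) \<omega>"
proof -
  note Q = power_sum_pos[OF n]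
  define t where "t = sqrt (2 * power_sum n)"
  have t: "0 < t" using Q by (simp add: t_def)
  have summand: "\<kappa> n (Suc j) * (g (Suc j) + \<sigma> / sqrt (real n) * \<xi> (Suc j) \<omega>)\<^sup>2
      = noise_scale n * (weight n j * (std_signal n g j + \<xi> (Suc j) \<omega>)\<^sup>2)" for j
  proof -
    have "g (Suc j) + \<sigma> / sqrt (real n) * \<xi> (Suc j) \<omega> = \<sigma> / sqrt (real n) * (std_signal n g j + \<xi> (Suc j) \<omega>)"
      using n sigma by (simp add: std_signal_def field_simps)
    then have "(g (Suc j) + \<sigma> / sqrt (real n) * \<xi> (Suc j) \<omega>)\<^sup>2 = \<sigma>\<^sup>2 / real n * (std_signal n g j + \<xi> (Suc j) \<omega>)\<^sup>2"
      using n by (simp add: power_mult_distrib power_divide)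
    moreover have "\<kappa> n (Suc j) = weight n j * t" using t by (simp add: weight_def t_def)
    moreover have "noise_scale n = \<sigma>\<^sup>2 / real n * t" by (simp add: noise_scale_def t_def)
    ultimately show ?thesis by (simp only: mult_ac)
  qed
  have "(\<Sum>\<^sub>\<infinity>j\<in>{1..}. \<kappa> n j * (g j + \<sigma> / sqrt (real n) * \<xi> j \<omega>)\<^sup>2)
      = enn2real (\<Sum>j. ennreal (noise_scale n * (weight n j * (std_signal n g j + \<xi> (Suc j) \<omega>)\<^sup>2)))"
    using kpos by (subst infsum_atLeast1_eq_enn2real) (simp_all only: summand, simp)
  also have "\<dots> = noise_scale n * enn2real (\<Sum>j. ennreal (weight n j * (std_signal n g j + \<xi> (Suc j) \<omega>)\<^sup>2))"
    using noise_scale_pos[OF n] weight_nonneg by (simp add: ennreal_mult' enn2real_mult)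
  finally have 1: "(\<Sum>\<^sub>\<infinity>j\<in>{1..}. \<kappa> n j * (g j + \<sigma> / sqrt (real n) * \<xi> j \<omega>)\<^sup>2)
      = noise_scale n * enn2real (\<Sum>j. ennreal (weight n j * (std_signal n g j + \<xi> (Suc j) \<omega>)\<^sup>2))" .
  note sm = kappa_summable[OF n]
  have "rho \<kappa> n = (\<Sum>j. \<kappa> n (Suc j))"
    unfolding rho_def using kpos sm by (intro infsum_atLeast1_eq_suminf) auto
  moreover have "(\<Sum>j. weight n j) = (\<Sum>j. \<kappa> n (Suc j)) / t"
    unfolding weight_def t_def by (rule suminf_divide[OF sm])
  ultimately have "\<sigma>\<^sup>2 / real n * rho \<kappa> n = noise_scale n * (\<Sum>j. weight n j)"
    using t by (simp add: noise_scale_def t_def)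
  then show ?thesis
    unfolding Tstat_def noise.quad_def 1 by (simp only: right_diff_distrib)
qed

lemma errII_eq:
  assumes "1 \<le> n"
  shows "errII M \<sigma> \<kappa> \<xi> n g t = noise.quad_cdf (weight n) (std_signal n g) (t / noise_scale n)"
  unfolding errII_def noise.quad_cdf_def Tstat_eq_quad[OF assms] pos_le_divide_eq[OF noise_scale_pos[OF assms]]
  by (simp only: mult.commute)

lemma errI_eq:
  assumes "1 \<le> n"
  shows "errI M \<sigma> \<kappa> \<xi> n t = 1 - noise.quad_cdf (weight n) (\<lambda>_. 0) (t / noise_scale n)"
proof -
  have zero: "std_signal n (\<lambda>_. 0) = (\<lambda>_. 0)" by (simp add: std_signal_def fun_eq_iff)
  have "{\<omega> \<in> space M. Tstat \<sigma> \<kappa> \<xi> n (\<lambda>_. 0) \<omega> > t}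
      = space M - {\<omega> \<in> space M. noise.quad (weight n) (\<lambda>_. 0) \<omega> \<le> t / noise_scale n}"
    unfolding Tstat_eq_quad[OF assms] using noise_scale_pos[OF assms] zero by (auto simp: field_simps)
  moreover have "prob (space M - {\<omega> \<in> space M. noise.quad (weight n) (\<lambda>_. 0) \<omega> \<le> t / noise_scale n})
      = 1 - prob {\<omega> \<in> space M. noise.quad (weight n) (\<lambda>_. 0) \<omega> \<le> t / noise_scale n}"
    by (rule prob_compl) measurable
  ultimately show ?thesis unfolding errI_def noise.quad_cdf_def by simp
qed

lemma energy_summand_le:
  assumes "1 \<le> n" "1 \<le> j"
  shows "\<kappa> n j * (g j)\<^sup>2 \<le> \<kappa> n 1 * (g j)\<^sup>2"
  using kappa_antimono[of n 1 j] assms by (intro mult_right_mono) auto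

lemma energy_summable:
  assumes "1 \<le> n" "ell2 g"
  shows "(\<lambda>j. \<kappa> n j * (g j)\<^sup>2) summable_on {1..}"
proof -
  have "(\<lambda>j. \<kappa> n 1 * (g j)\<^sup>2) summable_on {1..}"
    using assms by (intro summable_on_cmult_right) (simp add: ell2_def)
  then show ?thesis
    by (rule summable_on_comparison_test) (use assms kpos energy_summand_le in auto)
qed

lemma energy_le:
  assumes "1 \<le> n" "ell2 g"
  shows "energy n g \<le> \<kappa> n 1 * (l2norm g)\<^sup>2"
proof -
  have g: "(\<lambda>j. (g j)\<^sup>2) summable_on {1..}" using assms by (simp add: ell2_def)
  have "energy n g \<le> (\<Sum>\<^sub>\<infinity>j\<in>{1..}. \<kappa> n 1 * (g j)\<^sup>2)"
    unfolding energy_def using assms(1) energy_summand_le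
    by (intro infsum_mono energy_summable assms summable_on_cmult_right g) auto
  also have "\<dots> = \<kappa> n 1 * (\<Sum>\<^sub>\<infinity>j\<in>{1..}. (g j)\<^sup>2)"
    by (rule infsum_cmult_right) (use g in auto)
  also have "(\<Sum>\<^sub>\<infinity>j\<in>{1..}. (g j)\<^sup>2) = (l2norm g)\<^sup>2"
    by (simp add: l2norm_def infsum_nonneg)
  finally show ?thesis .
qed

text \<open>Identifies the mean shift of the standardised statistic, the quantity \<mu> of
  \<open>quad_cdf_shift\<close>, as energy divided by null standard deviation.\<close>

lemma std_signal_energy:
  assumes n: "1 \<le> n" and g: "ell2 g"
  shows "(\<lambda>j. weight n j * (std_signal n g j)\<^sup>2) sums (energy n g / noise_scale n)"
proof -
  have sm: "summable (\<lambda>j. \<kappa> n (Suc j) * (g (Suc j))\<^sup>2)"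
    using energy_summable[OF assms] summable_on_atLeast1_iff[of "\<lambda>j. \<kappa> n j * (g j)\<^sup>2"] kpos by simp
  then have "energy n g = (\<Sum>j. \<kappa> n (Suc j) * (g (Suc j))\<^sup>2)"
    unfolding energy_def using kpos by (subst infsum_atLeast1_eq_suminf) auto
  then have "(\<lambda>j. \<kappa> n (Suc j) * (g (Suc j))\<^sup>2 / noise_scale n) sums (energy n g / noise_scale n)"
    using sm by (intro sums_divide) (simp add: summable_sums)
  moreover have "weight n j * (std_signal n g j)\<^sup>2 = \<kappa> n (Suc j) * (g (Suc j))\<^sup>2 / noise_scale n" for j
    using n sigma power_sum_pos[OF n]
    by (simp add: weight_def std_signal_def noise_scale_def power_divide power_mult_distrib mult_ac)
  ultimately show ?thesis by (simp only:)
qed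

section \<open>Error probabilities of the tests\<close>

lemma noise_scale_orders:
  obtains c C where "0 < c" "0 < C" "\<And>n. 1 \<le> n \<Longrightarrow> c * real n powr (-2) \<le> noise_scale n"
    "\<And>n. 1 \<le> n \<Longrightarrow> noise_scale n \<le> C * real n powr (-2)"
proof -
  obtain c C where c: "0 < c" "0 < C" "\<And>n. 1 \<le> n \<Longrightarrow> c * real n powr (-2) \<le> power_sum n"
    "\<And>n. 1 \<le> n \<Longrightarrow> power_sum n \<le> C * real n powr (-2)"
    using weight_orders by metis
  have eq: "\<sigma>\<^sup>2 / real n * sqrt (2 * (x * real n powr (-2))) = \<sigma>\<^sup>2 * sqrt (2 * x) * real n powr (-2)"
    if "1 \<le> n" for n x
  proof -
    have p: "real n powr (-2) = 1 / (real n)\<^sup>2" using that by (simp add: powr_minus_divide)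
    show ?thesis unfolding p using that
      by (simp add: real_sqrt_mult real_sqrt_divide power2_eq_square)
  qed
  show ?thesis
  proof (rule that[of "\<sigma>\<^sup>2 * sqrt (2 * c)" "\<sigma>\<^sup>2 * sqrt (2 * C)"])
    fix n :: nat assume n: "1 \<le> n"
    show "\<sigma>\<^sup>2 * sqrt (2 * c) * real n powr (-2) \<le> noise_scale n"
      unfolding noise_scale_def eq[OF n, symmetric] using c(3)[OF n]
      by (intro mult_left_mono real_sqrt_le_mono) auto
    show "noise_scale n \<le> \<sigma>\<^sup>2 * sqrt (2 * C) * real n powr (-2)"
      unfolding noise_scale_def eq[OF n, symmetric] using c(4)[OF n]
      by (intro mult_left_mono real_sqrt_le_mono) auto
  qed (use sigma c in auto)
qed

text \<open>The first weight is O(n^(2r-2)) while the denominator is of order n^(-1), so the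
  quotient is O(n^(2r-1)), which vanishes because r < 1/2. This is the condition for asymptotic
  normality.\<close>

lemma max_weight_tendsto:
  assumes ns: "filterlim ns at_top sequentially" "\<And>i. 1 \<le> ns i"
  shows "(\<lambda>i. \<kappa> (ns i) 1 / sqrt (2 * power_sum (ns i))) \<longlonglongrightarrow> 0"
proof -
  obtain c C where c: "0 < c" "0 < C" "\<And>n. 1 \<le> n \<Longrightarrow> c * real n powr (-2) \<le> power_sum n"
    "\<And>n. 1 \<le> n \<Longrightarrow> \<kappa> n 1 \<le> C * real n powr (2*r - 2)"
    using weight_orders by metis
  have bound: "\<kappa> n 1 / sqrt (2 * power_sum n) \<le> C / sqrt (2 * c) * real n powr (2*r - 1)" if n: "1 \<le> n" for n
  proof -
    have p: "real n powr (-2) = 1 / (real n)\<^sup>2" using n by (simp add: powr_minus_divide)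
    have p': "real n powr (2*r - 1) = real n powr (2*r - 2) * real n"
      using n powr_add[of "real n" "2*r - 2" 1] by simp
    have "sqrt (2 * c) / real n = sqrt (2 * (c * real n powr (-2)))"
      unfolding p using n by (simp add: real_sqrt_mult real_sqrt_divide)
    also have "\<dots> \<le> sqrt (2 * power_sum n)" using c(3)[OF n] by simp
    finally have "\<kappa> n 1 / sqrt (2 * power_sum n) \<le> (C * real n powr (2*r - 2)) / (sqrt (2 * c) / real n)"
      using c(4)[OF n] c(1,2) n by (intro frac_le) auto
    then show ?thesis unfolding p' by simp
  qed
  have "(\<lambda>i. real (ns i) powr (2*r - 1)) \<longlonglongrightarrow> 0"
    using r ns by (intro tendsto_neg_powr filterlim_compose[OF filterlim_real_sequentially]) auto
  then have lim: "(\<lambda>i. C / sqrt (2 * c) * real (ns i) powr (2*r - 1)) \<longlonglongrightarrow> 0"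
    by (rule tendsto_mult_right_zero)
  have "0 \<le> \<kappa> (ns i) 1 / sqrt (2 * power_sum (ns i))" for i
    using kpos power_sum_pos[OF ns(2), of i] by simp
  then show ?thesis
    using bound[OF ns(2)]
    by (intro tendsto_sandwich[OF always_eventually always_eventually tendsto_const lim]) auto
qed

text \<open>At norm O(n^(-r)) the energy is O(n^(2r-2) n^(-2r)) = O(n^(-2)), the order of the null
  standard deviation.\<close>

lemma signal_upper:
  assumes "0 < B"
  obtains D where "\<And>n g. 1 \<le> n \<Longrightarrow> ell2 g \<Longrightarrow> l2norm g \<le> B * real n powr (-r) \<Longrightarrow> energy n g / noise_scale n \<le> D"
proof -
  obtain C where C: "0 < C" "\<And>n. 1 \<le> n \<Longrightarrow> \<kappa> n 1 \<le> C * real n powr (2*r - 2)"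
    using weight_orders by metis
  obtain c where c: "0 < c" "\<And>n. 1 \<le> n \<Longrightarrow> c * real n powr (-2) \<le> noise_scale n"
    using noise_scale_orders by metis
  show ?thesis
  proof (rule that[of "C * B\<^sup>2 / c"])
    fix n g assume n: "(1::nat) \<le> n" and g: "ell2 g" and gB: "l2norm g \<le> B * real n powr (-r)"
    have "energy n g \<le> \<kappa> n 1 * (l2norm g)\<^sup>2" by (rule energy_le[OF n g])
    also have "\<dots> \<le> (C * real n powr (2*r - 2)) * (B * real n powr (-r))\<^sup>2"
      using kpos C C(2)[OF n] gB l2norm_nonneg[of g] by (intro mult_mono power_mono) auto
    also have "\<dots> = C * B\<^sup>2 * (real n powr (2*r - 2) * (real n powr (-r))\<^sup>2)"
      by (simp add: power_mult_distrib)
    also have "real n powr (2*r - 2) * (real n powr (-r))\<^sup>2 = real n powr (-2)"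
      using n by (simp add: power2_eq_square powr_add[symmetric])
    finally have E: "energy n g \<le> C * B\<^sup>2 * real n powr (-2)" .
    have cn: "0 < c * real n powr (-2)" using c n by simp
    have "energy n g / noise_scale n \<le> (C * B\<^sup>2 * real n powr (-2)) / (c * real n powr (-2))"
      using E c(2)[OF n] cn C by (intro frac_le) auto
    also have "\<dots> = C * B\<^sup>2 / c" using n by simp
    finally show "energy n g / noise_scale n \<le> C * B\<^sup>2 / c" .
  qed
qed

text \<open>\<open>quad_detectable\<close> in terms of the original tests, with thresholds divided
  by \<open>noise_scale\<close>. A fixed q below 1 - \<alpha> is produced, since the strict
  inequality for the limsup in \<open>consistent\<close> asks for a gap that does not close.\<close>

lemma power_of_test:
  assumes ns: "filterlim ns at_top sequentially" "\<And>i. 1 \<le> ns i"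
    and g: "\<And>i. ell2 (g i)" "0 < B" "\<And>i. l2norm (g i) \<le> B * real (ns i) powr (-r)"
    and a: "0 < a" "\<And>i. a * real (ns i) powr (-2) \<le> energy (ns i) (g i)"
    and \<alpha>: "0 < \<alpha>" "\<alpha> < 1" "(\<lambda>i. errI M \<sigma> \<kappa> \<xi> (ns i) (t i)) \<longlonglongrightarrow> \<alpha>"
  obtains q where "q < 1 - \<alpha>" "\<forall>\<^sub>F i in sequentially. errII M \<sigma> \<kappa> \<xi> (ns i) (g i) (t i) \<le> q"
proof -
  let ?w = "\<lambda>i. weight (ns i)" and ?h = "\<lambda>i. std_signal (ns i) (g i)" and ?x = "\<lambda>i. t i / noise_scale (ns i)"
  obtain C where C: "0 < C" "\<And>n. 1 \<le> n \<Longrightarrow> noise_scale n \<le> C * real n powr (-2)"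
    using noise_scale_orders by metis
  obtain D where D: "\<And>n g. 1 \<le> n \<Longrightarrow> ell2 g \<Longrightarrow> l2norm g \<le> B * real n powr (-r) \<Longrightarrow> energy n g / noise_scale n \<le> D"
    using signal_upper[OF g(2)] by blast
  have sums: "(\<lambda>j. ?w i j * (?h i j)\<^sup>2) sums (energy (ns i) (g i) / noise_scale (ns i))" for i
    by (rule std_signal_energy[OF ns(2) g(1)])
  have low: "a / C \<le> energy (ns i) (g i) / noise_scale (ns i)" for i
  proof -
    have "0 < real (ns i) powr (-2)" using ns(2)[of i] by simp
    then have "a / C = (a * real (ns i) powr (-2)) / (C * real (ns i) powr (-2))" by simp
    also have "\<dots> \<le> energy (ns i) (g i) / noise_scale (ns i)"
    proof (rule frac_le)
      show "0 \<le> energy (ns i) (g i)" 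
        unfolding energy_def by (intro infsum_nonneg mult_nonneg_nonneg) (use kpos in auto)
    qed (use a(2) C(2) noise_scale_pos ns(2) in auto)
    finally show ?thesis .
  qed
  have "(\<lambda>i. 1 - errI M \<sigma> \<kappa> \<xi> (ns i) (t i)) \<longlonglongrightarrow> 1 - \<alpha>" by (intro tendsto_intros \<alpha>)
  then have "(\<lambda>i. noise.quad_cdf (?w i) (\<lambda>_. 0) (?x i)) \<longlonglongrightarrow> 1 - \<alpha>"
    by (simp add: errI_eq[OF ns(2)])
  then obtain q where "q < 1 - \<alpha>" "\<forall>\<^sub>F i in sequentially. noise.quad_cdf (?w i) (?h i) (?x i) \<le> q"
  proof (rule noise.quad_detectable[of ?w "\<lambda>i. \<kappa> (ns i) 1 / sqrt (2 * power_sum (ns i))" ?h "a / C" D "1 - \<alpha>" ?x, rotated -2])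
    show "(\<lambda>i. \<kappa> (ns i) 1 / sqrt (2 * power_sum (ns i))) \<longlonglongrightarrow> 0" by (rule max_weight_tendsto[OF ns])
    show "a / C \<le> (\<Sum>j. ?w i j * (?h i j)\<^sup>2)" for i
      using sums[of i] low[of i] by (simp add: sums_iff)
    show "(\<Sum>j. ?w i j * (?h i j)\<^sup>2) \<le> D" for i
      using sums[of i] D[OF ns(2) g(1) g(3)] by (simp add: sums_iff)
    show "summable (\<lambda>j. ?w i j * (?h i j)\<^sup>2)" for i using sums[of i] by (simp add: sums_iff)
  qed (rule weight_nonneg weight_summable weight_le weight_normalised ns(2) | use a(1) C(1) \<alpha>(1,2) in simp)+
  then show ?thesis by (intro that[of q]) (simp_all add: errII_eq[OF ns(2)])
qed

text \<open>Energy negligible against n^(-2) is negligible against the null standard deviation, so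
  \<open>quad_undetectable\<close> applies; its uniformity covers thresholds that behave arbitrarily
  along the sequence.\<close>

lemma inconsistent_if_energy_vanishes:
  assumes ns: "filterlim ns at_top sequentially" "\<And>i. 1 \<le> ns i"
    and g: "\<And>i. ell2 (g i)"
    and e: "(\<lambda>i. energy (ns i) (g i) / real (ns i) powr (-2)) \<longlonglongrightarrow> 0"
  shows "inconsistent M \<sigma> \<kappa> \<xi> ns g"
proof -
  let ?w = "\<lambda>i. weight (ns i)" and ?h = "\<lambda>i. std_signal (ns i) (g i)"
  obtain c where c: "0 < c" "\<And>n. 1 \<le> n \<Longrightarrow> c * real n powr (-2) \<le> noise_scale n"
    using noise_scale_orders by metis
  have sums: "(\<lambda>j. ?w i j * (?h i j)\<^sup>2) sums (energy (ns i) (g i) / noise_scale (ns i))" for i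
    by (rule std_signal_energy[OF ns(2) g(1)])
  have e0: "0 \<le> energy n h" for n h
    unfolding energy_def by (intro infsum_nonneg mult_nonneg_nonneg) (use kpos in auto)
  have le: "energy (ns i) (g i) / noise_scale (ns i) \<le> (energy (ns i) (g i) / real (ns i) powr (-2)) / c" for i
  proof -
    have "0 < c * real (ns i) powr (-2)" using c(1) ns(2)[of i] by simp
    then have "energy (ns i) (g i) / noise_scale (ns i) \<le> energy (ns i) (g i) / (c * real (ns i) powr (-2))"
      using e0 c(2)[OF ns(2)] by (intro frac_le) auto
    then show ?thesis by (simp add: mult.commute)
  qed
  have "(\<lambda>i. energy (ns i) (g i) / noise_scale (ns i)) \<longlonglongrightarrow> 0"
  proof (rule tendsto_sandwich[OF _ _ tendsto_const])
    show "(\<lambda>i. (energy (ns i) (g i) / real (ns i) powr (-2)) / c) \<longlonglongrightarrow> 0"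
      using tendsto_divide[OF e tendsto_const, of c] c(1) by simp
  qed (use le e0 noise_scale_pos ns(2) in \<open>auto intro!: always_eventually divide_nonneg_pos\<close>)
  moreover have "(\<Sum>j. ?w i j * (?h i j)\<^sup>2) = energy (ns i) (g i) / noise_scale (ns i)" for i
    using sums[of i] by (simp add: sums_iff)
  ultimately have \<mu>: "(\<lambda>i. \<Sum>j. ?w i j * (?h i j)\<^sup>2) \<longlonglongrightarrow> 0" by simp
  have ev: "\<forall>\<^sub>F i in sequentially. \<forall>x. noise.quad_cdf (?w i) (\<lambda>_. 0) x - noise.quad_cdf (?w i) (?h i) x \<le> \<epsilon>"
    if "0 < \<epsilon>" for \<epsilon>
  proof (rule noise.quad_undetectable[of ?w "\<lambda>i. \<kappa> (ns i) 1 / sqrt (2 * power_sum (ns i))" ?h])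
    show "(\<lambda>i. \<kappa> (ns i) 1 / sqrt (2 * power_sum (ns i))) \<longlonglongrightarrow> 0" by (rule max_weight_tendsto[OF ns])
    show "summable (\<lambda>j. ?w i j * (?h i j)\<^sup>2)" for i using sums[of i] by (simp add: sums_iff)
  qed (rule weight_nonneg weight_summable weight_le weight_normalised ns(2) \<mu> that)+
  show ?thesis
    unfolding inconsistent_def
  proof (rule allI, rule ereal_le_epsilon2)
    fix t :: "nat \<Rightarrow> real" and \<epsilon> :: real
    assume "0 < \<epsilon>"
    let ?L = "\<lambda>i. errI M \<sigma> \<kappa> \<xi> (ns i) (t i) + errII M \<sigma> \<kappa> \<xi> (ns i) (g i) (t i)"
    have "\<forall>\<^sub>F i in sequentially. ereal (1 - \<epsilon>) \<le> ereal (?L i)"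
      using ev[OF \<open>0 < \<epsilon>\<close>]
    proof eventually_elim
      case (elim i)
      show ?case using spec[OF elim, of "t i / noise_scale (ns i)"]
        by (simp add: errI_eq[OF ns(2)] errII_eq[OF ns(2)])
    qed
    then have "ereal (1 - \<epsilon>) \<le> liminf (\<lambda>i. ereal (?L i))" by (rule Liminf_bounded)
    then have "ereal (1 - \<epsilon>) + ereal \<epsilon> \<le> liminf (\<lambda>i. ereal (?L i)) + ereal \<epsilon>" by (rule add_right_mono)
    then show "1 \<le> liminf (\<lambda>i. ereal (?L i)) + ereal \<epsilon>" by (simp add: one_ereal_def)
  qed
qed

text \<open>The tests with threshold 0 are the witness. Their level tends to a value strictly
  between 0 and 1, and their type II error eventually stays a fixed amount below the complement of
  that value.\<close>

lemma not_inconsistent_if_energy_bounded_below: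
  assumes ns: "filterlim ns at_top sequentially" "\<And>i. 1 \<le> ns i"
    and g: "\<And>i. ell2 (g i)" "0 < B" "\<And>i. l2norm (g i) \<le> B * real (ns i) powr (-r)"
    and a: "0 < a" "\<And>i. a * real (ns i) powr (-2) \<le> energy (ns i) (g i)"
  shows "\<not> inconsistent M \<sigma> \<kappa> \<xi> ns g"
proof
  assume inc: "inconsistent M \<sigma> \<kappa> \<xi> ns g"
  let ?p = "cdf std_normal_distribution 0"
  have "(\<lambda>i. noise.quad_cdf (weight (ns i)) (\<lambda>_. 0) 0) \<longlonglongrightarrow> ?p"
    by (rule noise.quad_clt[OF _ _ _ _ max_weight_tendsto[OF ns]])
       (rule weight_nonneg weight_summable weight_le weight_normalised ns(2))+
  then have "(\<lambda>i. 1 - noise.quad_cdf (weight (ns i)) (\<lambda>_. 0) 0) \<longlonglongrightarrow> 1 - ?p" by (intro tendsto_intros)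
  then have I: "(\<lambda>i. errI M \<sigma> \<kappa> \<xi> (ns i) 0) \<longlonglongrightarrow> 1 - ?p" by (simp add: errI_eq[OF ns(2)])
  obtain q where q: "q < 1 - (1 - ?p)" "\<forall>\<^sub>F i in sequentially. errII M \<sigma> \<kappa> \<xi> (ns i) (g i) 0 \<le> q"
    using power_of_test[OF ns g a _ _ I] cdf_std_normal_in_unit[of 0] by auto
  \<comment> \<open>Half of the gap is spent on the convergence of the level; the other half keeps
    the sum of both errors at or below 1 - m.\<close>
  define m where "m = (?p - q) / 2"
  have "0 < m" using q(1) by (simp add: m_def)
  then have "\<forall>\<^sub>F i in sequentially. errI M \<sigma> \<kappa> \<xi> (ns i) 0 < 1 - ?p + m"
    using I by (intro order_tendstoD(2)) auto
  with q(2) have "\<forall>\<^sub>F i in sequentially. ereal (errI M \<sigma> \<kappa> \<xi> (ns i) 0 + errII M \<sigma> \<kappa> \<xi> (ns i) (g i) 0) \<le> ereal (1 - m)"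
    by eventually_elim (simp add: m_def field_simps)
  then have "limsup (\<lambda>i. ereal (errI M \<sigma> \<kappa> \<xi> (ns i) 0 + errII M \<sigma> \<kappa> \<xi> (ns i) (g i) 0)) \<le> ereal (1 - m)"
    by (rule Limsup_bounded)
  moreover have "1 \<le> liminf (\<lambda>i. ereal (errI M \<sigma> \<kappa> \<xi> (ns i) 0 + errII M \<sigma> \<kappa> \<xi> (ns i) (g i) 0))"
    using inc unfolding inconsistent_def by (rule spec[where x="\<lambda>_. 0"])
  moreover have "liminf (\<lambda>i. ereal (errI M \<sigma> \<kappa> \<xi> (ns i) 0 + errII M \<sigma> \<kappa> \<xi> (ns i) (g i) 0))
      \<le> limsup (\<lambda>i. ereal (errI M \<sigma> \<kappa> \<xi> (ns i) 0 + errII M \<sigma> \<kappa> \<xi> (ns i) (g i) 0))"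
    by (rule Liminf_le_Limsup) simp
  ultimately have "1 \<le> ereal (1 - m)" by (meson order_trans)
  then show False using \<open>0 < m\<close> by (simp add: one_ereal_def)
qed

lemma consistent_if_energy_bounded_below:
  assumes f: "\<And>n. ell2 (f n)" "0 < B" "\<And>n. 1 \<le> n \<Longrightarrow> l2norm (f n) \<le> B * real n powr (-r)"
    and a: "0 < a" "\<And>n. 1 \<le> n \<Longrightarrow> a * real n powr (-2) \<le> energy n (f n)"
  shows "consistent M \<sigma> \<kappa> \<xi> id f"
  unfolding consistent_def
proof (intro allI impI, elim conjE)
  fix \<alpha> :: real and t :: "nat \<Rightarrow> real"
  assume \<alpha>: "0 < \<alpha>" "\<alpha> < 1" "(\<lambda>i. errI M \<sigma> \<kappa> \<xi> (id i) (t i)) \<longlonglongrightarrow> \<alpha>"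
  \<comment> \<open>The bounds on f start at n = 1. The index 0 does not influence limits, so the
    sequence is shifted by one.\<close>
  have I: "(\<lambda>i. errI M \<sigma> \<kappa> \<xi> (Suc i) (t (Suc i))) \<longlonglongrightarrow> \<alpha>"
    using LIMSEQ_Suc[OF \<alpha>(3)] by simp
  have 1: "filterlim Suc at_top sequentially" by (rule filterlim_Suc)
  obtain q where q: "q < 1 - \<alpha>" "\<forall>\<^sub>F i in sequentially. errII M \<sigma> \<kappa> \<xi> (Suc i) (f (Suc i)) (t (Suc i)) \<le> q"
    by (rule power_of_test[OF 1 _ f(1) f(2) f(3) a(1) a(2) \<alpha>(1,2) I]) simp_all
  have "\<forall>\<^sub>F i in sequentially. ereal (errII M \<sigma> \<kappa> \<xi> (id i) (f i) (t i)) \<le> ereal q"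
    using q(2) by (subst eventually_sequentially_Suc[symmetric]) simp
  then have "limsup (\<lambda>i. ereal (errII M \<sigma> \<kappa> \<xi> (id i) (f i) (t i))) \<le> ereal q" by (rule Limsup_bounded)
  also have "\<dots> < ereal (1 - \<alpha>)" using q(1) by simp
  finally show "limsup (\<lambda>i. ereal (errII M \<sigma> \<kappa> \<xi> (id i) (f i) (t i))) < ereal (1 - \<alpha>)" .
qed

section \<open>Pure consistency and Besov balls\<close>

text \<open>Weights decrease, so frequencies up to m are seen with weight at least
  \<open>\<kappa> n m\<close>.\<close>

lemma energy_ge_head:
  assumes n: "1 \<le> n" and g: "ell2 g"
  shows "\<kappa> n m * (l2norm (head m g))\<^sup>2 \<le> energy n g"
proof -
  have "\<kappa> n m * (l2norm (head m g))\<^sup>2 = (\<Sum>j\<in>{1..m}. \<kappa> n m * (g j)\<^sup>2)"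
    by (simp add: l2norm_head sum_distrib_left)
  also have "\<dots> \<le> (\<Sum>j\<in>{1..m}. \<kappa> n j * (g j)\<^sup>2)"
    using kappa_antimono[OF n] by (intro sum_mono mult_right_mono) auto
  also have "\<dots> \<le> energy n g"
    unfolding energy_def by (rule finite_sum_le_infsum[OF energy_summable[OF assms]]) (use kpos in auto)
  finally show ?thesis .
qed

lemma energy_tail_le:
  assumes n: "1 \<le> n" and m: "1 \<le> m" and g: "ell2 g"
  shows "energy n (tail m g) \<le> \<kappa> n m * (l2norm g)\<^sup>2"
proof -
  have sq: "(\<lambda>j. (g j)\<^sup>2) summable_on {1..}" using g by (simp add: ell2_def)
  have "\<kappa> n j * (tail m g j)\<^sup>2 \<le> \<kappa> n m * (g j)\<^sup>2" if "1 \<le> j" for j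
    using kappa_antimono[OF n m, of j] kpos by (auto simp: tail_def intro!: mult_right_mono)
  then have "energy n (tail m g) \<le> (\<Sum>\<^sub>\<infinity>j\<in>{1..}. \<kappa> n m * (g j)\<^sup>2)"
    unfolding energy_def
    by (intro infsum_mono energy_summable n ell2_head_tail g summable_on_cmult_right sq) auto
  also have "\<dots> = \<kappa> n m * (l2norm g)\<^sup>2"
    unfolding l2norm_square by (rule infsum_cmult_right) (use sq in auto)
  finally show ?thesis .
qed

text \<open>The Besov side of the equivalence, written out exactly as in the theorem.\<close>

definition approximable :: "(nat \<Rightarrow> nat \<Rightarrow> real) \<Rightarrow> bool" where
  "approximable f \<longleftrightarrow> (\<forall>\<epsilon>>0. \<exists>P>0. \<exists>f1 :: nat \<Rightarrow> nat \<Rightarrow> real. \<forall>n\<ge>1.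
        ell2 (f1 n) \<and> f1 n \<in> besov (r / (2 - 4 * r)) P
      \<and> l2norm (\<lambda>j. f n j - f1 n j) \<le> \<epsilon> * real n powr (-r)
      \<and> (l2norm (f n))^2 = (l2norm (f1 n))^2 + (l2norm (\<lambda>j. f n j - f1 n j))^2)"

text \<open>The identity that singles out s: a cut-off of order n^(2-4r), raised to the power 2s, is
  of order n^(2r), so Besov tails beyond the cut-off have squared norm of order n^(-2r).\<close>

lemma besov_exponent: "0 < r / (2 - 4*r)" "(2 - 4*r) * (2 * (r / (2 - 4*r))) = 2 * r"
  using r by (auto simp: field_simps)

text \<open>Orthogonality makes the squared norm of g its inner product with f, which splits into
  three parts: the head of g against f1, g against the tail of f1, and g against f - f1. The last
  two are absorbed in the left side, so the head of g has norm of order at least n^(-r). By A5 the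
  weights up to the cut-off are still of order \<open>kappa_n\<close>, hence this head is visible.
  The bound is uniform in g.\<close>

lemma energy_bounded_below_if_approximable:
  assumes app: "approximable f" and f: "\<And>n. ell2 (f n)"
    and B: "0 < B" "\<And>n. 1 \<le> n \<Longrightarrow> l2norm (f n) \<le> B * real n powr (-r)" and "0 < c1"
  obtains a where "0 < a"
    "\<And>n g. 1 \<le> n \<Longrightarrow> ell2 g \<Longrightarrow> l2inner g (\<lambda>j. f n j - g j) = 0 \<Longrightarrow> c1 * real n powr (-r) \<le> l2norm g
      \<Longrightarrow> a * real n powr (-2) \<le> energy n g"
proof -
  define s where "s = r / (2 - 4*r)"
  have s: "0 < s" "(2 - 4*r) * (2 * s) = 2 * r" unfolding s_def using besov_exponent by auto
  \<comment> \<open>The approximation error and the Besov tail are each kept below c1/4 times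
    n^(-r), so that together they use up half of c1.\<close>
  have "0 < c1 / 4" using \<open>0 < c1\<close> by simp
  then have "\<exists>P>0. \<exists>f1 :: nat \<Rightarrow> nat \<Rightarrow> real. \<forall>n\<ge>1. ell2 (f1 n) \<and> f1 n \<in> besov s P
      \<and> l2norm (\<lambda>j. f n j - f1 n j) \<le> c1 / 4 * real n powr (-r)
      \<and> (l2norm (f n))\<^sup>2 = (l2norm (f1 n))\<^sup>2 + (l2norm (\<lambda>j. f n j - f1 n j))\<^sup>2"
    by (rule app[unfolded approximable_def, rule_format, folded s_def])
  then obtain P f1 where P: "0 < P" and all: "\<forall>n\<ge>1. ell2 (f1 n) \<and> f1 n \<in> besov s P
      \<and> l2norm (\<lambda>j. f n j - f1 n j) \<le> c1 / 4 * real n powr (-r)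
      \<and> (l2norm (f n))\<^sup>2 = (l2norm (f1 n))\<^sup>2 + (l2norm (\<lambda>j. f n j - f1 n j))\<^sup>2" by blast
  have f1: "ell2 (f1 n)" "f1 n \<in> besov s P" "l2norm (\<lambda>j. f n j - f1 n j) \<le> c1 / 4 * real n powr (-r)"
    "(l2norm (f n))\<^sup>2 = (l2norm (f1 n))\<^sup>2 + (l2norm (\<lambda>j. f n j - f1 n j))\<^sup>2" if "1 \<le> n" for n
    using all that by blast+
  obtain c where c: "0 < c" "\<And>n. 1 \<le> n \<Longrightarrow> 1 \<le> kn \<kappa> n"
    "\<And>n. 1 \<le> n \<Longrightarrow> c * real n powr (2*r - 2) \<le> kappa_n \<kappa> n"
    "\<And>n. 1 \<le> n \<Longrightarrow> c * real n powr (2 - 4*r) \<le> real (kn \<kappa> n)"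
    using weight_orders by metis
  \<comment> \<open>Chosen so that X^(2s) = 16 P / c1^2. Once k c \<ge> X, the cut-off m is at least
    X n^(2-4r), and the Besov bound P / m^(2s) for the squared tail of f1 is at most (c1/4)^2
    n^(-2r).\<close>
  define X where "X = (16 * P / c1\<^sup>2) powr (1 / (2 * s))"
  \<comment> \<open>For an integer k the product with \<open>kn \<kappa> n\<close> is an integer and
    the floor in A5 disappears; A5 asks for a factor above 1.\<close>
  obtain k :: nat where k: "max 2 (X / c) < real k" using reals_Archimedean2 by blast
  have k2: "1 < real k" using k by simp
  have "X \<le> real k * c" using k c(1) by (simp add: field_simps)
  have "16 * P / c1\<^sup>2 = X powr (2 * s)"
    unfolding X_def powr_powr using s(1) P \<open>0 < c1\<close> by simp
  also have "\<dots> \<le> (real k * c) powr (2 * s)"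
    using \<open>X \<le> real k * c\<close> s(1) by (intro powr_mono2) (auto simp: X_def)
  finally have kc: "16 * P / c1\<^sup>2 \<le> (real k * c) powr (2 * s)" .
  obtain K where K: "0 < K" "\<And>n. 1 \<le> n \<Longrightarrow> K * kappa_n \<kappa> n \<le> \<kappa> n (nat \<lfloor>real k * real (kn \<kappa> n)\<rfloor>)"
    using A5b k2 by blast
  \<comment> \<open>K c n^(2r-2) bounds the weight at the cut-off from below, and c1^2 / (2 B)
    n^(-r) the norm of the head of g.\<close>
  define a where "a = K * c * (c1\<^sup>2 / (2 * B))\<^sup>2"
  have "0 < a" unfolding a_def using K(1) c(1) B(1) \<open>0 < c1\<close> by simp
  then show thesis
  proof (rule that)
    fix n g
    assume n: "1 \<le> n" and g: "ell2 g" and orth: "l2inner g (\<lambda>j. f n j - g j) = 0"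
      and gc: "c1 * real n powr (-r) \<le> l2norm g"
    define N where "N = real n powr (-r)"
    define m where "m = k * kn \<kappa> n"
    have N: "0 < N" unfolding N_def using n by simp
    have N2: "real n powr (-(2*r)) = N\<^sup>2" by (simp add: N_def power2_eq_square powr_add[symmetric])
    have m_floor: "nat \<lfloor>real k * real (kn \<kappa> n)\<rfloor> = m"
      unfolding m_def by (simp flip: of_nat_mult)
    have m0: "0 < real m" unfolding m_def using c(2)[OF n] k2 by simp
    have tail_small: "l2norm (tail m (f1 n)) \<le> c1 / 4 * N"
    proof (rule power2_le_imp_le)
      have "(16 * P / c1\<^sup>2) / N\<^sup>2 \<le> (real k * c) powr (2 * s) / N\<^sup>2"
        using kc by (intro divide_right_mono) auto
      also have "\<dots> = (real k * c * real n powr (2 - 4*r)) powr (2 * s)"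
      proof -
        have "(real n powr (2 - 4*r)) powr (2 * s) = 1 / N\<^sup>2"
          using n unfolding powr_powr s(2) by (simp add: powr_minus_divide flip: N2)
        then show ?thesis using c(1) by (simp add: powr_mult)
      qed
      also have "\<dots> \<le> real m powr (2 * s)"
      proof (rule powr_mono2)
        show "real k * c * real n powr (2 - 4*r) \<le> real m"
          unfolding m_def of_nat_mult mult.assoc using c(4)[OF n] by (intro mult_left_mono) auto
      qed (use s(1) c(1) in auto)
      finally have *: "(16 * P / c1\<^sup>2) / N\<^sup>2 \<le> real m powr (2 * s)" .
      have "real m powr (2 * s) * (l2norm (tail m (f1 n)))\<^sup>2 \<le> P"
        using f1(2)[OF n] m0 unfolding besov_def l2norm_tail by blast
      moreover have "(16 * P / c1\<^sup>2) / N\<^sup>2 * (l2norm (tail m (f1 n)))\<^sup>2 \<le> real m powr (2 * s) * (l2norm (tail m (f1 n)))\<^sup>2"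
        using * by (intro mult_right_mono) auto
      ultimately have "(16 * P / c1\<^sup>2) / N\<^sup>2 * (l2norm (tail m (f1 n)))\<^sup>2 \<le> P" by linarith
      then have "16 * (l2norm (tail m (f1 n)))\<^sup>2 \<le> c1\<^sup>2 * N\<^sup>2"
        using P N \<open>0 < c1\<close> by (simp add: field_simps)
      then show "(l2norm (tail m (f1 n)))\<^sup>2 \<le> (c1 / 4 * N)\<^sup>2"
        by (simp add: power_mult_distrib power_divide field_simps)
    qed (use N \<open>0 < c1\<close> in simp)
    have f1B: "l2norm (f1 n) \<le> B * N"
    proof -
      have "l2norm (f1 n) \<le> l2norm (f n)"
        by (rule power2_le_imp_le) (simp_all add: f1(4)[OF n] l2norm_nonneg)
      then show ?thesis using B(2)[OF n] by (simp add: N_def)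
    qed
    let ?x = "l2norm g" and ?G = "l2norm (head m g)"
    have x0: "0 \<le> ?x" by (rule l2norm_nonneg)
    have "?x\<^sup>2 = l2inner g (f n)"
      using l2inner_diff_right[OF g f g, of n] orth by (simp add: l2inner_self)
    also have "\<dots> = l2inner g (f1 n) + l2inner g (\<lambda>j. f n j - f1 n j)"
      using l2inner_diff_right[OF g f f1(1)[OF n], of n] by simp
    also have "l2inner g (f1 n) = l2inner (head m g) (f1 n) + l2inner g (tail m (f1 n))"
      by (rule l2inner_head_tail[OF g f1(1)[OF n]])
    finally have "?x\<^sup>2 = l2inner (head m g) (f1 n) + l2inner g (tail m (f1 n)) + l2inner g (\<lambda>j. f n j - f1 n j)" .
    moreover have "l2inner (head m g) (f1 n) \<le> ?G * (B * N)"
      by (rule order_trans[OF l2inner_Cauchy_Schwarz[OF ell2_head_tail(1)[OF g] f1(1)[OF n]] mult_left_mono[OF f1B l2norm_nonneg]])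
    moreover have "l2inner g (tail m (f1 n)) \<le> ?x * (c1 / 4 * N)"
      by (rule order_trans[OF l2inner_Cauchy_Schwarz[OF g ell2_head_tail(2)[OF f1(1)[OF n]]] mult_left_mono[OF tail_small x0]])
    moreover have "l2inner g (\<lambda>j. f n j - f1 n j) \<le> ?x * (c1 / 4 * N)"
      by (rule order_trans[OF l2inner_Cauchy_Schwarz[OF g ell2_diff[OF f f1(1)[OF n]]] mult_left_mono[OF f1(3)[OF n, folded N_def] x0]])
    ultimately have 1: "?x\<^sup>2 \<le> ?G * (B * N) + ?x * (c1 * N) / 2" by (simp add: field_simps)
    \<comment> \<open>Because of this the term with c1 is at most half of the squared norm, and only
      the head of g remains to account for the other half.\<close>
    have gc': "c1 * N \<le> ?x" using gc by (simp add: N_def)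
    then have "?x * (c1 * N) \<le> ?x\<^sup>2" using x0 by (simp add: power2_eq_square mult_left_mono)
    with 1 have "?x\<^sup>2 / 2 \<le> ?G * (B * N)" by linarith
    moreover have "(c1 * N)\<^sup>2 \<le> ?x\<^sup>2" using gc' N \<open>0 < c1\<close> by (intro power_mono) auto
    ultimately have "(c1 * N)\<^sup>2 / 2 \<le> ?G * (B * N)" by linarith
    then have "c1\<^sup>2 / (2 * B) * N \<le> ?G"
      using N B(1) by (simp add: field_simps power2_eq_square)
    then have G: "(c1\<^sup>2 / (2 * B) * N)\<^sup>2 \<le> ?G\<^sup>2"
      using N B(1) by (intro power_mono) auto
    have "a * real n powr (-2) = K * (c * real n powr (2*r - 2)) * (c1\<^sup>2 / (2 * B) * N)\<^sup>2"
    proof -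
      have "real n powr (-2) = real n powr (2*r - 2) * N\<^sup>2"
        using n unfolding N2[symmetric] by (simp add: powr_add[symmetric])
      then show ?thesis unfolding a_def power_mult_distrib by (simp only: mult_ac)
    qed
    also have "\<dots> \<le> \<kappa> n m * ?G\<^sup>2"
    proof (rule mult_mono)
      have "K * (c * real n powr (2*r - 2)) \<le> K * kappa_n \<kappa> n"
        using c(3)[OF n] K(1) by (intro mult_left_mono) auto
      then show "K * (c * real n powr (2*r - 2)) \<le> \<kappa> n m"
        using K(2)[OF n] by (simp add: m_floor)
    qed (use G kpos in auto)
    also have "\<dots> \<le> energy n g" by (rule energy_ge_head[OF n g])
    finally show "a * real n powr (-2) \<le> energy n g" .
  qed
qed

text \<open>The lower bound on the energy is used twice: for g = f it gives consistency, and for an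
  orthogonal part of norm at least of order n^(-r) it excludes inconsistency.\<close>

lemma purely_consistent_if_approximable:
  assumes app: "approximable f" and f: "\<And>n. ell2 (f n)"
    and c: "0 < c" "\<And>n. 1 \<le> n \<Longrightarrow> c * real n powr (-r) \<le> l2norm (f n)"
    and B: "0 < B" "\<And>n. 1 \<le> n \<Longrightarrow> l2norm (f n) \<le> B * real n powr (-r)"
  shows "purely_r_consistent M \<sigma> \<kappa> \<xi> r f"
  unfolding purely_r_consistent_def r_consistent_def
proof (intro conjI notI)
  obtain a where a: "0 < a"
    "\<And>n g. 1 \<le> n \<Longrightarrow> ell2 g \<Longrightarrow> l2inner g (\<lambda>j. f n j - g j) = 0 \<Longrightarrow> c * real n powr (-r) \<le> l2norm g
      \<Longrightarrow> a * real n powr (-2) \<le> energy n g"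
    using energy_bounded_below_if_approximable[OF app f B c(1)] by blast
  \<comment> \<open>f qualifies as an orthogonal part of itself, with remainder 0.\<close>
  have "l2inner (f n) (\<lambda>j. f n j - f n j) = 0" for n by (simp add: l2inner_def)
  then show "consistent M \<sigma> \<kappa> \<xi> id f"
    using a c f B by (intro consistent_if_energy_bounded_below[OF f B a(1)]) auto
  \<comment> \<open>Halving c and adding c to B turns the weak bounds into the strict ones of
    \<open>r_consistent\<close>, with the constants in strict order.\<close>
  have "c / 2 * real n powr (-r) < l2norm (f n) \<and> l2norm (f n) < (B + c) * real n powr (-r)" if "1 \<le> n" for n
  proof -
    have "0 < c * real n powr (-r)" using c(1) that by simp
    then show ?thesis using c(2)[OF that] B(2)[OF that] by (simp add: distrib_right)
  qed
  moreover have "0 < c / 2" "c / 2 < B + c" using c(1) B(1) by auto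
  ultimately show "\<exists>c C. 0 < c \<and> c < C \<and> (\<forall>n\<ge>1. c * real n powr (-r) < l2norm (f n)
                                      \<and> l2norm (f n) < C * real n powr (-r))" by blast
next
  assume "\<exists>ns f2 c1. strict_mono ns \<and> (\<forall>i. 1 \<le> ns i) \<and> 0 < c1 \<and>
          (\<forall>i. ell2 (f2 i) \<and> l2inner (f2 i) (\<lambda>j. f (ns i) j - f2 i j) = 0
               \<and> l2norm (f2 i) > c1 * real (ns i) powr (-r)) \<and>
          inconsistent M \<sigma> \<kappa> \<xi> ns f2"
  then obtain ns f2 c1 where ns: "strict_mono ns" "\<And>i. 1 \<le> ns i" and c1: "0 < c1"
    and f2: "\<And>i. ell2 (f2 i)" "\<And>i. l2inner (f2 i) (\<lambda>j. f (ns i) j - f2 i j) = 0"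
      "\<And>i. c1 * real (ns i) powr (-r) < l2norm (f2 i)"
    and inc: "inconsistent M \<sigma> \<kappa> \<xi> ns f2" by blast
  obtain a where a: "0 < a"
    "\<And>n g. 1 \<le> n \<Longrightarrow> ell2 g \<Longrightarrow> l2inner g (\<lambda>j. f n j - g j) = 0 \<Longrightarrow> c1 * real n powr (-r) \<le> l2norm g
      \<Longrightarrow> a * real n powr (-2) \<le> energy n g"
    using energy_bounded_below_if_approximable[OF app f B c1] by blast
  have "l2norm (f2 i) \<le> B * real (ns i) powr (-r)" for i
    using l2norm_le_if_orthogonal[OF f2(1) f f2(2), of i] B(2)[OF ns(2)[of i]] by linarith
  then have "\<not> inconsistent M \<sigma> \<kappa> \<xi> ns f2"
    using a(2)[OF ns(2) f2(1) f2(2) less_imp_le[OF f2(3)]]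
    by (intro not_inconsistent_if_energy_bounded_below[OF filterlim_subseq[OF ns(1)] ns(2) f2(1) B(1) _ a(1)]) auto
  then show False using inc by contradiction
qed

text \<open>By contradiction. For each k some n has a large tail beyond
  \<open>k * kn \<kappa> n\<close>, and such n grow with k, since the tails of a single
  \<open>f n\<close> vanish. This yields a subsequence along which k tends to infinity. There the
  tails are orthogonal to the rest and by A4 have energy O(k^(-lam) n^(-2)); they form an
  inconsistent part, which pure consistency forbids.\<close>

lemma tails_small_if_purely_consistent:
  assumes pure: "purely_r_consistent M \<sigma> \<kappa> \<xi> r f" and f: "\<And>n. ell2 (f n)"
    and B: "0 < B" "\<And>n. 1 \<le> n \<Longrightarrow> l2norm (f n) \<le> B * real n powr (-r)" and "0 < \<epsilon>"
  obtains k :: nat where "2 \<le> k" "\<And>n. 1 \<le> n \<Longrightarrow> l2norm (tail (k * kn \<kappa> n) (f n)) \<le> \<epsilon> * real n powr (-r)"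
proof (rule ccontr)
  assume "\<not> thesis"
  then have big: "\<exists>n\<ge>1. \<epsilon> * real n powr (-r) < l2norm (tail (k * kn \<kappa> n) (f n))" if "2 \<le> k" for k
    using that \<open>\<And>k. 2 \<le> k \<Longrightarrow> (\<And>n. 1 \<le> n \<Longrightarrow> l2norm (tail (k * kn \<kappa> n) (f n)) \<le> \<epsilon> * real n powr (-r)) \<Longrightarrow> thesis\<close>
    by (meson not_le)
  obtain C where C: "0 < C" "\<And>n. 1 \<le> n \<Longrightarrow> 1 \<le> kn \<kappa> n"
    "\<And>n. 1 \<le> n \<Longrightarrow> kappa_n \<kappa> n \<le> C * real n powr (2*r - 2)"
    using weight_orders by metis
  have late: "\<exists>n k. N0 < n \<and> 1 \<le> n \<and> k0 + 2 \<le> k \<and> \<epsilon> * real n powr (-r) < l2norm (tail (k * kn \<kappa> n) (f n))" for N0 k0 :: nat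
  proof -
    have "\<exists>A. \<forall>m\<ge>A. l2norm (tail m (f n)) < \<epsilon> * real n powr (-r)" if "1 \<le> n" for n
    proof -
      have "0 < \<epsilon> * real n powr (-r)" using \<open>0 < \<epsilon>\<close> that by simp
      then have "\<forall>\<^sub>F m in sequentially. l2norm (tail m (f n)) < \<epsilon> * real n powr (-r)"
        by (rule order_tendstoD(2)[OF l2norm_tail_tendsto[OF f]])
      then show ?thesis by (simp add: eventually_sequentially)
    qed
    then obtain A where A: "\<And>n m. 1 \<le> n \<Longrightarrow> A n \<le> m \<Longrightarrow> l2norm (tail m (f n)) < \<epsilon> * real n powr (-r)"
      by metis
    \<comment> \<open>Large enough that every n up to \<open>N0\<close> has a small tail beyond k.
      An n whose tail is large for this k therefore exceeds \<open>N0\<close>.\<close>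
    define k where "k = k0 + 2 + (\<Sum>n\<le>N0. A n)"
    obtain n where n: "1 \<le> n" "\<epsilon> * real n powr (-r) < l2norm (tail (k * kn \<kappa> n) (f n))"
      using big[of k] by (auto simp: k_def)
    have "N0 < n"
    proof (rule ccontr)
      assume "\<not> N0 < n"
      then have "A n \<le> (\<Sum>n\<le>N0. A n)" by (intro member_le_sum) auto
      also have "\<dots> \<le> k * 1" by (simp add: k_def)
      also have "\<dots> \<le> k * kn \<kappa> n" using C(2)[OF n(1)] by (intro mult_left_mono) auto
      finally show False using A[OF n(1)] n(2) by fastforce
    qed
    then show ?thesis using n by (intro exI[of _ n] exI[of _ k]) (simp add: k_def)
  qed
  \<comment> \<open>A pair z holds a sample size and a cut-off factor; dependent choice makes the
    sample sizes strictly increasing while the factors are at least i + 2.\<close>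
  define ok where "ok i z \<longleftrightarrow> 1 \<le> fst z \<and> i + 2 \<le> snd z \<and>
      \<epsilon> * real (fst z) powr (-r) < l2norm (tail (snd z * kn \<kappa> (fst z)) (f (fst z)))" for i :: nat and z :: "nat \<times> nat"
  have "\<exists>z. \<forall>i. ok i (z i) \<and> fst (z i) < fst (z (Suc i))"
  proof (rule dependent_nat_choice)
    show "\<exists>z. ok 0 z" using late[of 0 0] by (auto simp: ok_def)
    show "\<exists>y. ok (Suc i) y \<and> fst z < fst y" if "ok i z" for z i
      using late[of "fst z" "Suc i"] unfolding ok_def by (metis fst_conv snd_conv)
  qed
  then obtain z where z: "\<And>i. ok i (z i)" "\<And>i. fst (z i) < fst (z (Suc i))" by blast
  define ns where "ns i = fst (z i)" for i
  define ks where "ks i = snd (z i)" for i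
  define f2 where "f2 i = tail (ks i * kn \<kappa> (ns i)) (f (ns i))" for i
  have ns: "strict_mono ns" "\<And>i. 1 \<le> ns i" and ks: "\<And>i. i + 2 \<le> ks i"
    and f2n: "\<And>i. \<epsilon> * real (ns i) powr (-r) < l2norm (f2 i)"
    using z unfolding ok_def ns_def ks_def f2_def by (auto simp: strict_mono_Suc_iff)
  have f2: "ell2 (f2 i)" for i unfolding f2_def by (rule ell2_head_tail(2)[OF f])
  have orth: "l2inner (f2 i) (\<lambda>j. f (ns i) j - f2 i j) = 0" for i
  proof -
    have "f2 i j * (f (ns i) j - f2 i j) = 0" for j by (simp add: f2_def tail_def)
    then show ?thesis unfolding l2inner_def by (rule infsum_0)
  qed
  obtain C1 lam where A4': "0 < C1" "1 < lam"
    "\<And>\<delta> n. 0 < \<delta> \<Longrightarrow> 1 \<le> n \<Longrightarrow> \<kappa> n (nat \<lfloor>(1 + \<delta>) * real (kn \<kappa> n)\<rfloor>) < C1 * (1 + \<delta>) powr (-lam) * kappa_n \<kappa> n"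
    using A4 by metis
  have bound: "energy (ns i) (f2 i) / real (ns i) powr (-2) \<le> C1 * C * B\<^sup>2 * real (ks i) powr (-lam)" for i
  proof -
    let ?n = "ns i" and ?k = "ks i"
    let ?m = "?k * kn \<kappa> ?n"
    have k2: "2 \<le> ?k" using ks[of i] by simp
    have m1: "1 \<le> ?m" using k2 C(2)[OF ns(2)[of i]] by (simp add: Suc_le_eq)
    \<comment> \<open>A4 with 1 + \<delta> equal to the integer factor, so that the floor is exact;
      a factor of at least 2 makes \<delta> positive.\<close>
    have "\<kappa> ?n ?m \<le> C1 * real ?k powr (-lam) * kappa_n \<kappa> ?n"
      using A4'(3)[of "real ?k - 1" ?n] k2 ns(2)[of i] by (simp flip: of_nat_mult)
    also have "\<dots> \<le> C1 * real ?k powr (-lam) * (C * real ?n powr (2*r - 2))"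
      using C(3)[OF ns(2)[of i]] A4'(1) by (intro mult_left_mono) auto
    finally have \<kappa>m: "\<kappa> ?n ?m \<le> C1 * real ?k powr (-lam) * (C * real ?n powr (2*r - 2))" .
    have "energy ?n (f2 i) \<le> \<kappa> ?n ?m * (l2norm (f ?n))\<^sup>2"
      unfolding f2_def by (rule energy_tail_le[OF ns(2) m1 f])
    also have "\<dots> \<le> (C1 * real ?k powr (-lam) * (C * real ?n powr (2*r - 2))) * (B * real ?n powr (-r))\<^sup>2"
      using \<kappa>m B(2)[OF ns(2)[of i]] l2norm_nonneg A4'(1) C(1) by (intro mult_mono power_mono) auto
    also have "\<dots> = C1 * C * B\<^sup>2 * real ?k powr (-lam) * (real ?n powr (2*r - 2) * (real ?n powr (-r))\<^sup>2)"
      by (simp add: power_mult_distrib)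
    also have "real ?n powr (2*r - 2) * (real ?n powr (-r))\<^sup>2 = real ?n powr (-2)"
      using ns(2)[of i] by (simp add: power2_eq_square powr_add[symmetric])
    finally show ?thesis using ns(2)[of i] by (simp add: divide_le_eq)
  qed
  have "inconsistent M \<sigma> \<kappa> \<xi> ns f2"
  proof (rule inconsistent_if_energy_vanishes[OF filterlim_subseq[OF ns(1)] ns(2) f2])
    have "filterlim ks at_top sequentially"
      by (rule filterlim_at_top_mono[OF filterlim_ident])
         (rule always_eventually, rule allI, rule add_leD1[OF ks])
    then have "(\<lambda>i. real (ks i) powr (-lam)) \<longlonglongrightarrow> 0"
      using A4'(2) by (intro tendsto_neg_powr filterlim_compose[OF filterlim_real_sequentially]) auto
    then have lim: "(\<lambda>i. C1 * C * B\<^sup>2 * real (ks i) powr (-lam)) \<longlonglongrightarrow> 0"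
      by (rule tendsto_mult_right_zero)
    have "0 \<le> energy (ns i) (f2 i) / real (ns i) powr (-2)" for i
      unfolding energy_def using kpos by (intro divide_nonneg_nonneg infsum_nonneg) auto
    then show "(\<lambda>i. energy (ns i) (f2 i) / real (ns i) powr (-2)) \<longlonglongrightarrow> 0"
      using bound by (intro tendsto_sandwich[OF always_eventually always_eventually tendsto_const lim]) auto
  qed
  then show False
    using pure ns f2 orth f2n \<open>0 < \<epsilon>\<close> unfolding purely_r_consistent_def by blast
qed

text \<open>For L \<ge> m nothing is left beyond L. For L < m the factor L^(2s) is at most D^(2s)
  n^(2r), which cancels the squared norm of order n^(-2r).\<close>

lemma head_in_besov:
  assumes n: "1 \<le> n" and g: "ell2 g" and B: "l2norm g \<le> B * real n powr (-r)"
    and m: "real m \<le> D * real n powr (2 - 4*r)" and "0 < D"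
  shows "head m g \<in> besov (r / (2 - 4*r)) (D powr (2 * (r / (2 - 4*r))) * B\<^sup>2)"
  unfolding besov_def
proof (intro CollectI allI impI)
  fix L :: real
  assume L: "0 < L"
  define s where "s = r / (2 - 4*r)"
  have s: "0 < s" "(2 - 4*r) * (2 * s) = 2 * r" unfolding s_def using besov_exponent by auto
  let ?J = "{j::nat. 1 \<le> j \<and> real j > L}"
  have "L powr (2 * s) * (\<Sum>\<^sub>\<infinity>j\<in>?J. (head m g j)\<^sup>2) \<le> D powr (2 * s) * B\<^sup>2"
  proof (cases "real m \<le> L")
    case True
    have "(\<Sum>\<^sub>\<infinity>j\<in>?J. (head m g j)\<^sup>2) = 0"
      by (rule infsum_0) (use True in \<open>auto simp: head_def\<close>)
    then show ?thesis by simp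
  next
    case False
    have sq: "(\<lambda>j. (head m g j)\<^sup>2) summable_on {1..}"
      using ell2_head_tail(1)[OF g] by (simp add: ell2_def)
    have "(\<Sum>\<^sub>\<infinity>j\<in>?J. (head m g j)\<^sup>2) \<le> (\<Sum>\<^sub>\<infinity>j\<in>{1..}. (head m g j)\<^sup>2)"
      by (rule infsum_mono_neutral[OF summable_on_subset_banach[OF sq] sq]) auto
    also have "\<dots> = (l2norm (head m g))\<^sup>2" by (simp add: l2norm_square)
    also have "\<dots> \<le> (l2norm g)\<^sup>2" using l2norm_head_tail[OF g, of m] by simp
    also have "\<dots> \<le> (B * real n powr (-r))\<^sup>2" using B l2norm_nonneg by (intro power_mono) auto
    finally have sum: "(\<Sum>\<^sub>\<infinity>j\<in>?J. (head m g j)\<^sup>2) \<le> (B * real n powr (-r))\<^sup>2" .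
    have "L powr (2 * s) \<le> (D * real n powr (2 - 4*r)) powr (2 * s)"
      using L False m s(1) by (intro powr_mono2) auto
    also have "\<dots> = D powr (2 * s) * real n powr (2 * r)"
      using \<open>0 < D\<close> by (simp add: powr_mult powr_powr s(2))
    finally have "L powr (2 * s) * (\<Sum>\<^sub>\<infinity>j\<in>?J. (head m g j)\<^sup>2)
        \<le> (D powr (2 * s) * real n powr (2 * r)) * (B * real n powr (-r))\<^sup>2"
      using sum by (intro mult_mono infsum_nonneg) auto
    also have "\<dots> = D powr (2 * s) * B\<^sup>2 * (real n powr (2 * r) * (real n powr (-r))\<^sup>2)"
      by (simp add: power_mult_distrib)
    also have "real n powr (2 * r) * (real n powr (-r))\<^sup>2 = 1"
      using n by (simp add: power2_eq_square powr_add[symmetric])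
    finally show ?thesis by simp
  qed
  then show "L powr (2 * (r / (2 - 4*r))) * (\<Sum>\<^sub>\<infinity>j\<in>?J. (head m g j)\<^sup>2)
      \<le> D powr (2 * (r / (2 - 4*r))) * B\<^sup>2"
    unfolding s_def .
qed

text \<open>The approximant is f truncated at \<open>k * kn \<kappa> n\<close>, with k from the
  smallness of the tails. Head and tail have disjoint supports, which gives the Pythagorean
  identity, and the order of \<open>kn\<close> places the head in a Besov ball of radius independent
  of n.\<close>

lemma approximable_if_purely_consistent:
  assumes pure: "purely_r_consistent M \<sigma> \<kappa> \<xi> r f" and f: "\<And>n. ell2 (f n)"
    and B: "0 < B" "\<And>n. 1 \<le> n \<Longrightarrow> l2norm (f n) \<le> B * real n powr (-r)"
  shows "approximable f"
  unfolding approximable_def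
proof (intro allI impI)
  fix \<epsilon> :: real
  assume \<epsilon>: "0 < \<epsilon>"
  obtain k :: nat where k: "2 \<le> k"
    "\<And>n. 1 \<le> n \<Longrightarrow> l2norm (tail (k * kn \<kappa> n) (f n)) \<le> \<epsilon> * real n powr (-r)"
    using tails_small_if_purely_consistent[OF pure f B \<epsilon>] by blast
  obtain C where C: "0 < C" "\<And>n. 1 \<le> n \<Longrightarrow> real (kn \<kappa> n) \<le> C * real n powr (2 - 4*r)"
    using weight_orders by metis
  define D where "D = real k * C"
  have D: "0 < D" unfolding D_def using k(1) C(1) by simp
  define P where "P = D powr (2 * (r / (2 - 4*r))) * B\<^sup>2"
  have "0 < P" unfolding P_def using D B(1) by simp
  moreover have "ell2 (head (k * kn \<kappa> n) (f n)) \<and> head (k * kn \<kappa> n) (f n) \<in> besov (r / (2 - 4 * r)) P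
      \<and> l2norm (\<lambda>j. f n j - head (k * kn \<kappa> n) (f n) j) \<le> \<epsilon> * real n powr (-r)
      \<and> (l2norm (f n))^2 = (l2norm (head (k * kn \<kappa> n) (f n)))^2
          + (l2norm (\<lambda>j. f n j - head (k * kn \<kappa> n) (f n) j))^2" if n: "1 \<le> n" for n
  proof -
    let ?m = "k * kn \<kappa> n"
    have t: "(\<lambda>j. f n j - head ?m (f n) j) = tail ?m (f n)" by (auto simp: head_def tail_def)
    have "real ?m \<le> D * real n powr (2 - 4*r)"
      unfolding D_def of_nat_mult mult.assoc using C(2)[OF n] by (intro mult_left_mono) auto
    then have "head ?m (f n) \<in> besov (r / (2 - 4*r)) P"
      unfolding P_def by (rule head_in_besov[OF n f B(2)[OF n] _ D])
    then show ?thesis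
      unfolding t using ell2_head_tail(1)[OF f] k(2)[OF n] l2norm_head_tail[OF f] by blast
  qed
  ultimately show "\<exists>P>0. \<exists>f1 :: nat \<Rightarrow> nat \<Rightarrow> real. \<forall>n\<ge>1.
        ell2 (f1 n) \<and> f1 n \<in> besov (r / (2 - 4 * r)) P
      \<and> l2norm (\<lambda>j. f n j - f1 n j) \<le> \<epsilon> * real n powr (-r)
      \<and> (l2norm (f n))^2 = (l2norm (f1 n))^2 + (l2norm (\<lambda>j. f n j - f1 n j))^2"
    by (intro exI[of _ P] conjI exI[of _ "\<lambda>n. head (k * kn \<kappa> n) (f n)"] allI impI) blast+
qed

end

theorem theorem11:
  fixes M :: "'a measure" and \<xi> :: "nat \<Rightarrow> 'a \<Rightarrow> real"
    and \<sigma> r :: real and \<kappa> :: "nat \<Rightarrow> nat \<Rightarrow> real" and f :: "nat \<Rightarrow> nat \<Rightarrow> real"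
  assumes P: "prob_space M"
    and indep: "prob_space.indep_vars M (\<lambda>_. borel) \<xi> UNIV"
    and gauss: "\<forall>j. distributed M lborel (\<xi> j) std_normal_density"
    and sigma: "\<sigma> > 0"
    and r: "0 < r" "r < 1/2"
    and kpos: "\<forall>n j. 0 \<le> \<kappa> n j"
    and ksum: "\<forall>n\<ge>1. \<kappa> n summable_on {1..}"
    and A1: "\<forall>n\<ge>1. \<forall>j\<ge>1. \<kappa> n (Suc j) \<le> \<kappa> n j"
    and A2: "\<exists>C1 C2. 0 < C1 \<and> (\<forall>n\<ge>1.
               C1 < \<sigma> powr (-4) * (real n)^2 * (\<Sum>\<^sub>\<infinity>j\<in>{1..}. (\<kappa> n j)^2)
             \<and> \<sigma> powr (-4) * (real n)^2 * (\<Sum>\<^sub>\<infinity>j\<in>{1..}. (\<kappa> n j)^2) < C2)"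
    and A3: "\<exists>c1 c2. 0 < c1 \<and> (\<forall>n\<ge>1. c1 * real n powr (-2*r) \<le> rho \<kappa> n
                                  \<and> rho \<kappa> n \<le> c2 * real n powr (-2*r))"
    and A4: "\<exists>C1 lam. C1 > 0 \<and> lam > 1 \<and> (\<forall>\<delta>>0. \<forall>n\<ge>1.
               \<kappa> n (nat \<lfloor>(1 + \<delta>) * real (kn \<kappa> n)\<rfloor>) < C1 * (1 + \<delta>) powr (-lam) * kappa_n \<kappa> n)"
    and A5a: "\<exists>c C. 0 < c \<and> (\<forall>n\<ge>1. c * kappa_n \<kappa> n \<le> \<kappa> n 1 \<and> \<kappa> n 1 \<le> C * kappa_n \<kappa> n)"
    and A5b: "\<forall>c>1. \<exists>C>0. \<forall>n\<ge>1. \<kappa> n (nat \<lfloor>c * real (kn \<kappa> n)\<rfloor>) \<ge> C * kappa_n \<kappa> n"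
    and fl2: "\<forall>n. ell2 (f n)"
    and fnorm: "\<exists>c C. 0 < c \<and> c < C \<and> (\<forall>n\<ge>1. c * real n powr (-r) \<le> l2norm (f n)
                                          \<and> l2norm (f n) \<le> C * real n powr (-r))"
  shows "purely_r_consistent M \<sigma> \<kappa> \<xi> r f \<longleftrightarrow>
    (\<forall>\<epsilon>>0. \<exists>P>0. \<exists>f1 :: nat \<Rightarrow> nat \<Rightarrow> real. \<forall>n\<ge>1.
        ell2 (f1 n) \<and> f1 n \<in> besov (r / (2 - 4 * r)) P
      \<and> l2norm (\<lambda>j. f n j - f1 n j) \<le> \<epsilon> * real n powr (-r)
      \<and> (l2norm (f n))^2 = (l2norm (f1 n))^2 + (l2norm (\<lambda>j. f n j - f1 n j))^2)"
proof -
  interpret prob_space M by fact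
  interpret quadratic_test M \<xi> \<sigma> r \<kappa>
    by unfold_locales fact+
  obtain c C where c: "0 < c" "c < C" "\<And>n. 1 \<le> n \<Longrightarrow> c * real n powr (-r) \<le> l2norm (f n)"
    "\<And>n. 1 \<le> n \<Longrightarrow> l2norm (f n) \<le> C * real n powr (-r)"
    using fnorm by blast
  have f: "ell2 (f n)" for n using fl2 by blast
  have C: "0 < C" using c by linarith
  have "purely_r_consistent M \<sigma> \<kappa> \<xi> r f \<longleftrightarrow> approximable f"
    using purely_consistent_if_approximable[OF _ f c(1,3) C c(4)]
      approximable_if_purely_consistent[OF _ f C c(4)] by blast
  then show ?thesis unfolding approximable_def .
qed

end
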